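(* Let $(\mathfrak g,\langle\cdot,\cdot\rangle)$ be a flat metric Lie algebra with decomposition $\mathfrak g=\mathfrak s\oplus\mathfrak z\oplus\bigoplus_{\ell=1}^m P_\ell$ and weights $\lambda_\ell$, and put $\mathfrak a=\mathfrak s\oplus\mathfrak z$. Assume $\lambda_i\neq\pm\lambda_j$ for all $i\neq j$. Let $\xi=\mathrm{ad}\,r+R$ with $r\in\wedge^2\mathfrak g$ and $R\in Z^1(\mathfrak g,\wedge^2\mathfrak g)$, and assume that $R(\mathfrak a)\subset(\wedge^2\mathfrak g)^{\mathfrak g}$ and that for each $\ell$ there is $A_\ell\in\mathfrak a$ with $R(u)=A_\ell\wedge u$ for all $u\in P_\ell$. Let $\Psi:=[r,r]+2\{r,R\}\in\wedge^3\mathfrak g$. Then the following are equivalent: (i) $\xi$ defines a Lie bialgebra structure on $\mathfrak g$, i.e. $\{\xi,\xi\}=0$; (ii) $\{R,R\}=0$ and $\delta\Psi=0$; (iii) $\{R,R\}=0$ and $\Psi\in(\wedge^3\mathfrak g)^{\mathfrak g}$.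
   Context: All Lie algebras are finite-dimensional and real. A flat metric Lie algebra is a Lie algebra $\mathfrak g$ with an inner product $\langle\cdot,\cdot\rangle$ such that the left-invariant Riemannian metric it induces on the simply connected Lie group of $\mathfrak g$ has zero curvature. By Milnor's theorem there is an orthogonal decomposition $\mathfrak g=\mathfrak s\oplus\mathfrak z\oplus\mathfrak u$, where $\mathfrak s$ is an abelian subalgebra, $\mathfrak z$ is the center of $\mathfrak g$, $\mathfrak u=[\mathfrak g,\mathfrak g]$ is an even-dimensional abelian ideal, and the operators $\mathrm{ad}_s|_{\mathfrak u}$ ($s\in\mathfrak s$) are skew-symmetric and commute pairwise. Moreover $\mathfrak u=\bigoplus_{\ell=1}^m P_\ell$ orthogonally, where the $P_\ell$ are $2$-dimensional and $\mathfrak s$-invariant, and there are nonzero weights $\lambda_\ell\in\mathfrak s^*\setminus\{0\}$ and orthogonal complex structures $J_\ell\in \mathrm{SO}(P_\ell)$ with $[s,v]=\lambda_\ell(s)J_\ell v$ for $s\in\mathfrak s$, $v\in P_\ell$. For $x\in\mathfrak g$, $\mathrm{ad}_x=[x,\cdot]$ is extended to $\wedge^k\mathfrak g$ as a derivation; $(\wedge^k\mathfrak g)^{\mathfrak g}$ is the space of elements killed by all $\mathrm{ad}_x$, $x\in\mathfrak g$. $Z^1(\mathfrak g,\wedge^2\mathfrak g)$ is the space of linear maps $\xi:\mathfrak g\to\wedge^2\mathfrak g$ with $\xi([x,y])=\mathrm{ad}_x\xi(y)-\mathrm{ad}_y\xi(x)$. For $r\in\wedge^2\mathfrak g$, $\mathrm{ad}\,r$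 is the map $x\mapsto\mathrm{ad}_xr$. A Lie bialgebra structure on $\mathfrak g$ is an element $\xi\in Z^1(\mathfrak g,\wedge^2\mathfrak g)$ such that $[\alpha,\beta]_*(x)=\langle\xi(x),\alpha\wedge\beta\rangle$ defines a Lie bracket on $\mathfrak g^*$; for a cocycle $\xi$ the latter (co-Jacobi) condition is $\{\xi,\xi\}=0$. Big Bracket. For a finite-dimensional real vector space $V$, give $\wedge^{q+1}V^*\otimes\wedge^{p+1}V\subset\wedge(V^*\oplus V)$ the degree $p+q$. The Big Bracket $\{\cdot,\cdot\}$ is the graded Lie bracket on $\wedge(V^*\oplus V)$, mapping bidegrees $(p,q)\times(p',q')$ to $(p+p',q+q')$, uniquely determined by: $\{\sigma,\sigma'\}=0$ if $\sigma,\sigma'$ both lie in $\mathbb R\oplus V$ or both in $\mathbb R\oplus V^*$; $\{\sigma,\sigma'\}=\sigma'(\sigma)$ for $\sigma\in V,\sigma'\in V^*$; and, for $\sigma$ of degree $k$ and $\sigma'$ of degree $k'$, $\{\sigma,\sigma'\wedge\sigma''\}=\{\sigma,\sigma'\}\wedge\sigma''+(-1)^{kk'}\sigma'\wedge\{\sigma,\sigma''\}$. It satisfies $\{\sigma,\sigma'\}=-(-1)^{kk'}\{\sigma',\sigma\}$ and the graded Jacobi identity $\{\sigma,\{\sigma',\sigma''\}\}=\{\{\sigma,\sigma'\},\sigma''\}+(-1)^{kk'}\{\sigma',\{\sigma,\sigma''\}\}$. Take $V=\mathfrak g$. Linear maps $\mathfrak g\to\wedge^k\mathfrak g$ are identified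 with elements of $\mathfrak g^*\otimes\wedge^k\mathfrak g$ (with $\alpha\otimes P$ corresponding to $x\mapsto\alpha(x)P$). The element $\mu\in\wedge^2\mathfrak g^*\otimes\mathfrak g$ encodes the Lie bracket, with sign normalized so that $\delta:=\{\mu,\cdot\}$ satisfies $(\delta\Theta)(x)=[x,\Theta]$ for $\Theta\in\wedge^k\mathfrak g$, $x\in\mathfrak g$; in particular $\delta r=\mathrm{ad}\,r$. The Schouten square of $r\in\wedge^2\mathfrak g$ is $[r,r]=\{r,\{\mu,r\}\}\in\wedge^3\mathfrak g$, so that $\{\mathrm{ad}\,r,\mathrm{ad}\,r\}=\delta[r,r]$. *)

theory Defs
  imports "HOL-Analysis.Analysis"
begin

text \<open>
  The shuffle product of two forms, organised by whether the first argument goes to \<open>f\<close> or, past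
  all arguments of \<open>f\<close>, to \<open>g\<close>.  The factor is $1$ (no factorials), so a product of one-forms is
  a determinant.
\<close>

primrec wedge_fun :: "('w list \<Rightarrow> real) \<Rightarrow> ('w list \<Rightarrow> real) \<Rightarrow> 'w list \<Rightarrow> real" where
  "wedge_fun f g [] = f [] * g []"
| "wedge_fun f g (w # ws) =
     wedge_fun (\<lambda>us. f (w # us)) g ws + wedge_fun (\<lambda>us. (-1) ^ length us * f us) (\<lambda>us. g (w # us)) ws"

text \<open>
  An element of the exterior algebra of a finite-dimensional space is a multilinear alternating
  form on the dual space; \<open>f\<close> collects the homogeneous components of all degrees, the component of
  degree $k$ being the restriction to lists of length $k$.  For multilinear forms, vanishing on
  adjacent equal arguments is the same as being alternating.
\<close>

definition alternating :: "('w::real_vector list \<Rightarrow> real) \<Rightarrow> bool" where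
  "alternating f \<longleftrightarrow>
     (\<forall>us vs. linear (\<lambda>w. f (us @ w # vs))) \<and>
     (\<forall>us w vs. f (us @ w # w # vs) = 0) \<and>
     (\<exists>n. \<forall>ws. n < length ws \<longrightarrow> f ws = 0)"

lemma wedge_fun_add_left:
  "wedge_fun (\<lambda>us. f us + f' us) g ws = wedge_fun f g ws + wedge_fun f' g ws"
  by (induction ws arbitrary: f f' g) (auto simp: algebra_simps)

lemma wedge_fun_add_right:
  "wedge_fun f (\<lambda>us. g us + g' us) ws = wedge_fun f g ws + wedge_fun f g' ws"
  by (induction ws arbitrary: f g g') (auto simp: algebra_simps)

lemma wedge_fun_scale_left: "wedge_fun (\<lambda>us. c * f us) g ws = c * wedge_fun f g ws"
proof (induction ws arbitrary: f g)
  case (Cons w ws)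
  have "(\<lambda>us. (-1) ^ length us * (c * f us)) = (\<lambda>us. c * ((-1) ^ length us * f us))"
    by (auto simp: algebra_simps)
  then show ?case by (simp add: Cons algebra_simps)
qed auto

lemma wedge_fun_scale_right: "wedge_fun f (\<lambda>us. c * g us) ws = c * wedge_fun f g ws"
  by (induction ws arbitrary: f g) (auto simp: algebra_simps)

lemma wedge_fun_zero_left [simp]: "wedge_fun (\<lambda>us. 0) g ws = 0"
  using wedge_fun_scale_left[of 0 "\<lambda>_. 0" g ws] by simp

lemma wedge_fun_zero_right [simp]: "wedge_fun f (\<lambda>us. 0) ws = 0"
  using wedge_fun_scale_right[of f 0 "\<lambda>_. 0" ws] by simp

lemma wedge_fun_minus_left: "wedge_fun (\<lambda>us. - f us) g ws = - wedge_fun f g ws"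
  using wedge_fun_scale_left[of "-1" f g ws] by simp

lemma wedge_fun_one_left: "wedge_fun (\<lambda>ws. if ws = [] then 1 else 0) g ws = g ws"
proof (induction ws arbitrary: g)
  case (Cons w ws)
  have "(\<lambda>us. (-1) ^ length us * (if us = [] then 1 else 0)) = (\<lambda>us::'a list. if us = [] then 1 else (0::real))"
    by auto
  then show ?case by (simp only: wedge_fun.simps Cons) simp
qed auto

lemma wedge_fun_one_right: "wedge_fun f (\<lambda>ws. if ws = [] then 1 else 0) ws = f ws"
  by (induction ws arbitrary: f) auto

lemma wedge_fun_invol:
  "(-1) ^ length ws * wedge_fun f g ws =
   wedge_fun (\<lambda>us. (-1) ^ length us * f us) (\<lambda>us. (-1) ^ length us * g us) ws"
proof (induction ws arbitrary: f g)
  case (Cons w ws)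
  have 1: "(\<lambda>us. (-1) ^ length (w # us) * f (w # us)) = (\<lambda>us. - ((-1) ^ length us * f (w # us)))"
    and 2: "(\<lambda>us. (-1) ^ length (w # us) * g (w # us)) = (\<lambda>us. (-1) * ((-1) ^ length us * g (w # us)))"
    by auto
  show ?case
    unfolding wedge_fun.simps 1 2 wedge_fun_minus_left wedge_fun_scale_right
    using Cons[of "\<lambda>us. f (w # us)" g] Cons[of "\<lambda>us. (-1) ^ length us * f us" "\<lambda>us. g (w # us)"]
    by (simp add: distrib_left)
qed auto

lemma wedge_fun_assoc: "wedge_fun (wedge_fun f g) h ws = wedge_fun f (wedge_fun g h) ws"
proof (induction ws arbitrary: f g h)
  case (Cons w ws)
  show ?case
    by (simp add: wedge_fun_add_left wedge_fun_add_right Cons wedge_fun_invol)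
qed auto

lemma wedge_fun_linear_arg:
  assumes "\<And>us vs. linear (\<lambda>w. f (us @ w # vs))" "\<And>us vs. linear (\<lambda>w. g (us @ w # vs))"
  shows "linear (\<lambda>w. wedge_fun f g (us @ w # vs))"
  using assms
proof (induction us arbitrary: f g)
  case Nil
  have f: "f ((x + y) # us) = f (x # us) + f (y # us)" "f ((c *\<^sub>R x) # us) = c * f (x # us)"
    and g: "g ((x + y) # us) = g (x # us) + g (y # us)" "g ((c *\<^sub>R x) # us) = c * g (x # us)" for x y c us
    using Nil(1)[of "[]" us] Nil(2)[of "[]" us] by (auto dest: linear_add linear_scale)
  show ?case
    by (rule linearI)
       (simp_all add: f g wedge_fun_add_left wedge_fun_add_right wedge_fun_scale_left
          wedge_fun_scale_right algebra_simps)
next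
  case (Cons u us)
  have a: "linear (\<lambda>w. f (u # us' @ w # vs'))" "linear (\<lambda>w. g (u # us' @ w # vs'))" for us' vs'
    using Cons.prems(1)[of "u # us'" vs'] Cons.prems(2)[of "u # us'" vs'] by auto
  have b: "linear (\<lambda>w. (-1) ^ length (us' @ w # vs') * f (us' @ w # vs'))" for us' vs'
  proof -
    have "linear (\<lambda>w. (-1) ^ Suc (length us' + length vs') *\<^sub>R f (us' @ w # vs'))"
      using Cons.prems(1)[of us' vs'] by (rule linear_compose_scale_right)
    then show ?thesis by simp
  qed
  show ?case
    unfolding append_Cons wedge_fun.simps
    by (intro linear_compose_add Cons.IH a b Cons.prems)
qed

lemma wedge_fun_alt_arg:
  assumes "\<And>us vs w. f (us @ w # w # vs) = 0" "\<And>us vs w. g (us @ w # w # vs) = 0"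
  shows "wedge_fun f g (us @ w # w # vs) = 0"
  using assms
proof (induction us arbitrary: f g)
  case Nil
  have "(\<lambda>us. (-1) ^ length (w # us) * f (w # us)) = (\<lambda>us. - ((-1) ^ length us * f (w # us)))"
    by auto
  with Nil(1)[of "[]"] Nil(2)[of "[]"] show ?case
    by (simp add: wedge_fun_minus_left)
next
  case (Cons u us)
  have "f (u # us' @ w # w # vs') = 0" "g (u # us' @ w # w # vs') = 0" for us' vs' w
    using Cons.prems(1)[of "u # us'" w vs'] Cons.prems(2)[of "u # us'" w vs'] by auto
  then show ?case
    by (simp add: Cons)
qed

lemma wedge_fun_bounded:
  assumes "\<And>ws. n < length ws \<Longrightarrow> f ws = 0" "\<And>ws. m < length ws \<Longrightarrow> g ws = 0"
    "n + m < length ws"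
  shows "wedge_fun f g ws = 0"
  using assms
proof (induction ws arbitrary: f g n m)
  case (Cons w ws)
  have "wedge_fun (\<lambda>us. f (w # us)) g ws = 0"
  proof (cases n)
    case 0
    then have "(\<lambda>us. f (w # us)) = (\<lambda>_. 0)" using Cons.prems by auto
    then show ?thesis by simp
  next
    case (Suc k) show ?thesis
      by (rule Cons.IH[of k _ m]) (use Suc Cons.prems in auto)
  qed
  moreover have "wedge_fun (\<lambda>us. (-1) ^ length us * f us) (\<lambda>us. g (w # us)) ws = 0"
  proof (cases m)
    case 0
    then have "(\<lambda>us. g (w # us)) = (\<lambda>_. 0)" using Cons.prems by auto
    then show ?thesis by simp
  next
    case (Suc k) show ?thesis
      by (rule Cons.IH[of n _ k]) (use Suc Cons.prems in auto)
  qed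
  ultimately show ?case by simp
qed auto

lemma alternating_wedge_fun:
  assumes "alternating f" "alternating g" shows "alternating (wedge_fun f g)"
proof -
  obtain n m where "\<And>ws. n < length ws \<Longrightarrow> f ws = 0" "\<And>ws. m < length ws \<Longrightarrow> g ws = 0"
    using assms unfolding alternating_def by blast
  then have "\<exists>n. \<forall>ws. n < length ws \<longrightarrow> wedge_fun f g ws = 0"
    using wedge_fun_bounded[of n f m g] by blast
  then show ?thesis
    using assms wedge_fun_linear_arg[of f g] wedge_fun_alt_arg[of f g]
    unfolding alternating_def by auto
qed

typedef (overloaded) ('w::real_vector) altform = "{f :: 'w list \<Rightarrow> real. alternating f}"
  morphisms apply_form Abs_altform
  by (rule exI[of _ "\<lambda>_. 0"]) (auto simp: alternating_def linear_iff)

setup_lifting type_definition_altform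

instantiation altform :: (real_vector) real_algebra_1
begin

lift_definition zero_altform :: "'a altform" is "\<lambda>_. 0"
  by (auto simp: alternating_def linear_iff)
lift_definition one_altform :: "'a altform" is "\<lambda>ws. if ws = [] then 1 else 0"
  by (auto simp: alternating_def linear_iff)
lift_definition plus_altform :: "'a altform \<Rightarrow> 'a altform \<Rightarrow> 'a altform" is "\<lambda>f g ws. f ws + g ws"
  unfolding alternating_def
  by (auto intro!: linear_compose_add)
     (metis (no_types, lifting) add.right_neutral max_less_iff_conj)
lift_definition uminus_altform :: "'a altform \<Rightarrow> 'a altform" is "\<lambda>f ws. - f ws"
  unfolding alternating_def by (auto intro!: linear_compose_neg)
lift_definition minus_altform :: "'a altform \<Rightarrow> 'a altform \<Rightarrow> 'a altform" is "\<lambda>f g ws. f ws - g ws"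
  unfolding alternating_def
  by (auto intro!: linear_compose_sub)
     (metis (no_types, lifting) diff_0_right max_less_iff_conj)
lift_definition scaleR_altform :: "real \<Rightarrow> 'a altform \<Rightarrow> 'a altform" is "\<lambda>c f ws. c * f ws"
  unfolding alternating_def
  using linear_compose_scale_right[where 'b=real] by auto
lift_definition times_altform :: "'a altform \<Rightarrow> 'a altform \<Rightarrow> 'a altform" is wedge_fun
  by (rule alternating_wedge_fun)

instance
proof
  fix a b c :: "'a altform" and x y :: real
  show "a * b * c = a * (b * c)"
    by transfer (auto simp: wedge_fun_assoc)
  show "(a + b) * c = a * c + b * c"
    by transfer (auto simp: wedge_fun_add_left)
  show "a * (b + c) = a * b + a * c"
    by transfer (auto simp: wedge_fun_add_right)
  show "1 * a = a"
    by transfer (auto simp: wedge_fun_one_left)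
  show "a * 1 = a"
    by transfer (auto simp: wedge_fun_one_right)
  show "(0::'a altform) \<noteq> 1"
    by transfer (auto simp: fun_eq_iff)
  show "x *\<^sub>R a * b = x *\<^sub>R (a * b)"
    by transfer (auto simp: wedge_fun_scale_left)
  show "a * x *\<^sub>R b = x *\<^sub>R (a * b)"
    by transfer (auto simp: wedge_fun_scale_right)
qed (transfer; auto simp: algebra_simps fun_eq_iff)+

end

lift_definition contract :: "'w::real_vector \<Rightarrow> 'w altform \<Rightarrow> 'w altform" is "\<lambda>w f ws. f (w # ws)"
proof -
  fix w :: 'w and f :: "'w list \<Rightarrow> real" assume f: "alternating f"
  then obtain n where n: "\<forall>ws. n < length ws \<longrightarrow> f ws = 0" unfolding alternating_def by blast
  show "alternating (\<lambda>ws. f (w # ws))"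
    unfolding alternating_def
  proof (intro conjI allI exI impI)
    fix us vs show "linear (\<lambda>x. f (w # us @ x # vs))"
      using f unfolding alternating_def append_Cons[symmetric] by blast
  next
    fix us x vs show "f (w # us @ x # x # vs) = 0"
      using f unfolding alternating_def append_Cons[symmetric] by blast
  next
    fix ws :: "'w list" assume "n < length ws" then show "f (w # ws) = 0" using n by simp
  qed
qed

lift_definition parity :: "'w::real_vector altform \<Rightarrow> 'w altform" is "\<lambda>f ws. (-1) ^ length ws * f ws"
proof -
  fix f :: "'w list \<Rightarrow> real" assume f: "alternating f"
  have "linear (\<lambda>w. (-1) ^ length (us @ w # vs) * f (us @ w # vs))" for us vs
  proof -
    have "linear (\<lambda>w. (-1) ^ Suc (length us + length vs) *\<^sub>R f (us @ w # vs))"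
      using f unfolding alternating_def by (intro linear_compose_scale_right) auto
    then show ?thesis by simp
  qed
  moreover obtain n where "\<forall>ws. n < length ws \<longrightarrow> f ws = 0"
    using f unfolding alternating_def by blast
  then have "\<exists>n. \<forall>ws. n < length ws \<longrightarrow> (-1) ^ length ws * f ws = 0" by auto
  ultimately show "alternating (\<lambda>ws. (-1) ^ length ws * f ws)"
    using f unfolding alternating_def by simp
qed

lemma apply_form_simps [simp]:
  "apply_form 0 ws = 0" "apply_form (\<sigma> + \<tau>) ws = apply_form \<sigma> ws + apply_form \<tau> ws"
  "apply_form (\<sigma> - \<tau>) ws = apply_form \<sigma> ws - apply_form \<tau> ws"
  "apply_form (- \<sigma>) ws = - apply_form \<sigma> ws"
  "apply_form (c *\<^sub>R \<sigma>) ws = c * apply_form \<sigma> ws"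
  "apply_form 1 ws = (if ws = [] then 1 else 0)"
  "apply_form (contract w \<sigma>) ws = apply_form \<sigma> (w # ws)"
  "apply_form (parity \<sigma>) ws = (-1) ^ length ws * apply_form \<sigma> ws"
  by (transfer; simp)+

lemma apply_form_times_Nil [simp]: "apply_form (\<sigma> * \<tau>) [] = apply_form \<sigma> [] * apply_form \<tau> []"
  by transfer simp

lemma altform_eqI: "(\<And>ws. apply_form \<sigma> ws = apply_form \<tau> ws) \<Longrightarrow> \<sigma> = \<tau>"
  by (auto simp: apply_form_inject[symmetric])

lemma altform_eq_contractI:
  assumes "apply_form \<sigma> [] = apply_form \<tau> []" "\<And>w. contract w \<sigma> = contract w \<tau>"
  shows "\<sigma> = \<tau>"
proof (rule altform_eqI)
  fix ws show "apply_form \<sigma> ws = apply_form \<tau> ws"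
    using assms(1) arg_cong[OF assms(2), of "\<lambda>x. apply_form x _"] by (cases ws) auto
qed

lemma apply_form_sum: "apply_form (\<Sum>i\<in>A. f i) ws = (\<Sum>i\<in>A. apply_form (f i) ws)"
  by (induction A rule: infinite_finite_induct) auto

lemma linear_contract: "linear (contract w)"
  by (rule linearI) (auto intro!: altform_eqI)
lemma linear_parity: "linear parity"
  by (rule linearI) (auto intro!: altform_eqI simp: algebra_simps)

lemmas contract_simps [simp] = linear_0[OF linear_contract] linear_add[OF linear_contract]
  linear_diff[OF linear_contract] linear_neg[OF linear_contract] linear_scale[OF linear_contract]
lemmas parity_simps [simp] = linear_0[OF linear_parity] linear_add[OF linear_parity]
  linear_diff[OF linear_parity] linear_neg[OF linear_parity] linear_scale[OF linear_parity]

lemma contract_sum: "contract w (\<Sum>i\<in>A. f i) = (\<Sum>i\<in>A. contract w (f i))"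
  by (rule linear_sum[OF linear_contract])
lemma parity_sum: "parity (\<Sum>i\<in>A. f i) = (\<Sum>i\<in>A. parity (f i))"
  by (rule linear_sum[OF linear_parity])

lemma contract_one [simp]: "contract w 1 = 0" by (rule altform_eqI) auto
lemma parity_one [simp]: "parity 1 = 1" by (rule altform_eqI) auto
lemma parity_parity [simp]: "parity (parity \<sigma>) = \<sigma>"
  by (rule altform_eqI) (simp flip: mult.assoc power_add)
lemma contract_parity: "contract w (parity \<sigma>) = - parity (contract w \<sigma>)"
  by (rule altform_eqI) simp
lemma parity_times: "parity (\<sigma> * \<tau>) = parity \<sigma> * parity \<tau>"
  by transfer (auto simp: wedge_fun_invol)
lemma contract_times: "contract w (\<sigma> * \<tau>) = contract w \<sigma> * \<tau> + parity \<sigma> * contract w \<tau>"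
  by transfer auto

lemma linear_apply_form: "linear (\<lambda>w. apply_form \<sigma> (us @ w # vs))"
  using apply_form[of \<sigma>] by (auto simp: alternating_def)

lemma apply_form_adjacent: "apply_form \<sigma> (us @ w # w # vs) = 0"
  using apply_form[of \<sigma>] by (auto simp: alternating_def)

lemma linear_contract_left: "linear (\<lambda>w. contract w \<sigma>)"
proof (rule linearI)
  fix x y :: 'a and c :: real
  show "contract (x + y) \<sigma> = contract x \<sigma> + contract y \<sigma>"
    using linear_add[OF linear_apply_form[of \<sigma> "[]"]] by (intro altform_eqI) simp
  show "contract (c *\<^sub>R x) \<sigma> = c *\<^sub>R contract x \<sigma>"
    using linear_scale[OF linear_apply_form[of \<sigma> "[]"]] by (intro altform_eqI) simp
qed

lemmas contract_left_simps = linear_0[OF linear_contract_left] linear_add[OF linear_contract_left]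
  linear_diff[OF linear_contract_left] linear_neg[OF linear_contract_left] linear_scale[OF linear_contract_left]

lemma contract_self: "contract w (contract w \<sigma>) = 0"
  using apply_form_adjacent[of \<sigma> "[]"] by (intro altform_eqI) simp

lemma contract_anticomm: "contract w (contract w' \<sigma>) = - contract w' (contract w \<sigma>)"
  using contract_self[of "w + w'" \<sigma>] contract_self[of w \<sigma>] contract_self[of w' \<sigma>]
  by (simp add: contract_left_simps add_eq_0_iff2)

text \<open>
  The exterior algebra $\bigwedge(V^* \oplus V)$, as forms on the dual space $V \oplus V^*$: a vector
  $v$ and a covector $\alpha$ are the one-forms sending $(x, \varphi)$ to $\varphi(v)$ and to
  $\alpha(x)$.  Bounded functionals are all functionals, $V$ being finite-dimensional.
  Multiplication in this algebra is the wedge product.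
\<close>

type_synonym 'a dual = "'a \<Rightarrow>\<^sub>L real"
type_synonym 'a dbl = "('a \<times> 'a dual) altform"

lemma alternating_single:
  assumes "linear f" shows "alternating (\<lambda>ws. if length ws = 1 then f (hd ws) else 0)"
  unfolding alternating_def
proof (intro conjI allI exI impI)
  fix us vs :: "'a list"
  show "linear (\<lambda>w. if length (us @ w # vs) = 1 then f (hd (us @ w # vs)) else 0)"
    using assms by (cases "us = [] \<and> vs = []") (auto simp: linear_iff)
next
  fix ws :: "'a list"
  show "1 < length ws \<Longrightarrow> (if length ws = 1 then f (hd ws) else 0) = 0" by simp
qed simp

definition of_vec :: "'a::real_normed_vector \<Rightarrow> 'a dbl" where
  "of_vec v = Abs_altform (\<lambda>ws. if length ws = 1 then blinfun_apply (snd (hd ws)) v else 0)"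

definition of_covec :: "'a::real_normed_vector dual \<Rightarrow> 'a dbl" where
  "of_covec \<alpha> = Abs_altform (\<lambda>ws. if length ws = 1 then blinfun_apply \<alpha> (fst (hd ws)) else 0)"

lemma apply_of_vec: "apply_form (of_vec v) ws = (if length ws = 1 then blinfun_apply (snd (hd ws)) v else 0)"
proof -
  have "linear (\<lambda>w::'a \<times> 'a dual. blinfun_apply (snd w) v)"
    by (rule linearI) (auto simp: blinfun.add_left blinfun.scaleR_left)
  from alternating_single[OF this] show ?thesis
    unfolding of_vec_def by (subst Abs_altform_inverse) auto
qed
lemma apply_of_covec: "apply_form (of_covec \<alpha>) ws = (if length ws = 1 then blinfun_apply \<alpha> (fst (hd ws)) else 0)"
proof -
  have "linear (\<lambda>w::'a \<times> 'a dual. blinfun_apply \<alpha> (fst w))"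
    by (rule linearI) (auto simp: blinfun.add_right blinfun.scaleR_right)
  from alternating_single[OF this] show ?thesis
    unfolding of_covec_def by (subst Abs_altform_inverse) auto
qed

lemma linear_of_vec: "linear of_vec"
  by (rule linearI)
     (auto intro!: altform_eqI simp: apply_of_vec blinfun.add_right blinfun.scaleR_right)
lemma linear_of_covec: "linear of_covec"
  by (rule linearI)
     (auto intro!: altform_eqI simp: apply_of_covec blinfun.add_left blinfun.scaleR_left)

lemma contract_of_vec [simp]: "contract (x, \<phi>) (of_vec v) = blinfun_apply \<phi> v *\<^sub>R 1"
  by (rule altform_eqI) (auto simp: apply_of_vec)
lemma contract_of_covec [simp]: "contract (x, \<phi>) (of_covec \<alpha>) = blinfun_apply \<alpha> x *\<^sub>R 1"
  by (rule altform_eqI) (auto simp: apply_of_covec)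
lemma parity_of_vec [simp]: "parity (of_vec v) = - of_vec v"
  by (rule altform_eqI) (auto simp: apply_of_vec)
lemma parity_of_covec [simp]: "parity (of_covec v) = - of_covec v"
  by (rule altform_eqI) (auto simp: apply_of_covec)

lemma apply_of_vec_Nil [simp]: "apply_form (of_vec v) [] = 0" by (simp add: apply_of_vec)
lemma apply_of_covec_Nil [simp]: "apply_form (of_covec v) [] = 0" by (simp add: apply_of_covec)

lemma apply_of_vec_times_of_vec:
  "apply_form (of_vec x * of_vec y) [(a, \<alpha>), (b, \<beta>)] =
     blinfun_apply \<alpha> x * blinfun_apply \<beta> y - blinfun_apply \<alpha> y * blinfun_apply \<beta> x"
proof -
  have "apply_form (of_vec x * of_vec y) [(a, \<alpha>), (b, \<beta>)] =
    apply_form (contract (b, \<beta>) (contract (a, \<alpha>) (of_vec x * of_vec y))) []" by simp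
  then show ?thesis unfolding contract_times by (simp add: contract_times)
qed


text \<open>
  \<open>bidegree p q\<close> is the image of $\bigwedge^{q+1} V^* \otimes \bigwedge^{p+1} V$ under
  $\alpha \otimes P \mapsto \alpha \wedge P$.  The indices are integers: for an index below $-1$ the
  space is zero.
\<close>

definition bidegree :: "int \<Rightarrow> int \<Rightarrow> 'a::real_normed_vector dbl set" where
  "bidegree p q = span {prod_list (map of_covec \<alpha>s) * prod_list (map of_vec vs) |\<alpha>s vs.
     int (length \<alpha>s) = q + 1 \<and> int (length vs) = p + 1}"

definition total_degree :: "int \<Rightarrow> 'a::real_normed_vector dbl set" where
  "total_degree k = span (\<Union>p q. if p + q = k then bidegree p q else {})"

definition is_big_bracket :: "('a::real_normed_vector dbl \<Rightarrow> 'a dbl \<Rightarrow> 'a dbl) \<Rightarrow> bool" where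
  "is_big_bracket B \<longleftrightarrow>
     bilinear B \<and>
     (\<forall>p q p' q'. \<forall>\<sigma>\<in>bidegree p q. \<forall>\<tau>\<in>bidegree p' q'. B \<sigma> \<tau> \<in> bidegree (p + p') (q + q')) \<and>
     (\<forall>k k'. \<forall>\<sigma>\<in>total_degree k. \<forall>\<tau>\<in>total_degree k'. B \<sigma> \<tau> = - ((-1) powi (k * k') *\<^sub>R B \<tau> \<sigma>)) \<and>
     (\<forall>k k'. \<forall>\<sigma>\<in>total_degree k. \<forall>\<tau>\<in>total_degree k'. \<forall>\<rho>.
        B \<sigma> (B \<tau> \<rho>) = B (B \<sigma> \<tau>) \<rho> + (-1) powi (k * k') *\<^sub>R B \<tau> (B \<sigma> \<rho>)) \<and>
     (\<forall>c c' x x'. B (of_real c + of_vec x) (of_real c' + of_vec x') = 0) \<and>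
     (\<forall>c c' \<alpha> \<alpha>'. B (of_real c + of_covec \<alpha>) (of_real c' + of_covec \<alpha>') = 0) \<and>
     (\<forall>x \<alpha>. B (of_vec x) (of_covec \<alpha>) = of_real (blinfun_apply \<alpha> x)) \<and>
     (\<forall>k k'. \<forall>\<sigma>\<in>total_degree k. \<forall>\<tau>\<in>total_degree k'. \<forall>\<rho>.
        B \<sigma> (\<tau> * \<rho>) = B \<sigma> \<tau> * \<rho> + (-1) powi (k * k') *\<^sub>R (\<tau> * B \<sigma> \<rho>))"

text \<open>
  For finite-dimensional spaces such a bracket exists and is unique: \<open>is_big_bracket_big_bracket\<close>,
  \<open>is_big_bracket_unique\<close>; an explicit formula is \<open>big_bracket_eq\<close>.
\<close>

definition big_bracket :: "'a::real_normed_vector dbl \<Rightarrow> 'a dbl \<Rightarrow> 'a dbl" where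
  "big_bracket = (THE B. is_big_bracket B)"

lemma powi_neg1: "(-1::real) powi k = (if even k then 1 else -1)"
  by (simp add: power_int_minus_left)

definition homogeneous :: "int \<Rightarrow> 'w::real_vector altform \<Rightarrow> bool" where
  "homogeneous k \<sigma> \<longleftrightarrow> (\<forall>ws. int (length ws) \<noteq> k + 2 \<longrightarrow> apply_form \<sigma> ws = 0)"

lemma homogeneous_0 [simp]: "homogeneous k 0" by (simp add: homogeneous_def)
lemma homogeneous_add: "homogeneous k \<sigma> \<Longrightarrow> homogeneous k \<tau> \<Longrightarrow> homogeneous k (\<sigma> + \<tau>)" by (simp add: homogeneous_def)
lemma homogeneous_scale: "homogeneous k \<sigma> \<Longrightarrow> homogeneous k (c *\<^sub>R \<sigma>)" by (simp add: homogeneous_def)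
lemma homogeneous_sum: "(\<And>i. i \<in> A \<Longrightarrow> homogeneous k (f i)) \<Longrightarrow> homogeneous k (\<Sum>i\<in>A. f i)"
  by (auto simp: homogeneous_def apply_form_sum)
lemma homogeneous_one: "homogeneous (-2) 1" by (auto simp: homogeneous_def)
lemma homogeneous_of_vec: "homogeneous (-1) (of_vec x)" by (auto simp: homogeneous_def apply_of_vec)
lemma homogeneous_of_covec: "homogeneous (-1) (of_covec x)" by (auto simp: homogeneous_def apply_of_covec)
lemma homogeneous_contract: "homogeneous k \<sigma> \<Longrightarrow> homogeneous (k - 1) (contract w \<sigma>)" by (auto simp: homogeneous_def)
lemma parity_hom: "homogeneous k \<sigma> \<Longrightarrow> parity \<sigma> = (-1) powi k *\<^sub>R \<sigma>"
proof (rule altform_eqI)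
  fix ws assume *: "homogeneous k \<sigma>"
  show "apply_form (parity \<sigma>) ws = apply_form ((-1) powi k *\<^sub>R \<sigma>) ws"
  proof (cases "int (length ws) = k + 2")
    case True
    then have "even (length ws) \<longleftrightarrow> even k" by presburger
    then show ?thesis by (simp add: powi_neg1 minus_one_power_iff)
  next
    case False with * show ?thesis by (simp add: homogeneous_def)
  qed
qed

lemma homogeneous_Nil: "homogeneous k \<sigma> \<Longrightarrow> k \<noteq> -2 \<Longrightarrow> apply_form \<sigma> [] = 0" by (simp add: homogeneous_def)
lemma homogeneous_single: "homogeneous k \<sigma> \<Longrightarrow> k \<noteq> -1 \<Longrightarrow> apply_form \<sigma> [v] = 0" by (simp add: homogeneous_def)
lemma homogeneous_pair: "homogeneous k \<sigma> \<Longrightarrow> k \<noteq> 0 \<Longrightarrow> apply_form \<sigma> [v, w] = 0" by (simp add: homogeneous_def)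

lemma homogeneous_zero_lt: "homogeneous k \<sigma> \<Longrightarrow> k < -2 \<Longrightarrow> \<sigma> = 0"
  by (rule altform_eqI) (auto simp: homogeneous_def)

lemma apply_times_comm:
  assumes "homogeneous k \<sigma>" "homogeneous l \<tau>"
  shows "apply_form (\<sigma> * \<tau>) ws = (-1) powi (k * l) * apply_form (\<tau> * \<sigma>) ws"
  using assms
proof (induction ws arbitrary: k l \<sigma> \<tau>)
  case Nil
  show ?case
  proof (cases "k = -2 \<and> l = -2")
    case True then show ?thesis by simp
  next
    case False
    then have "apply_form \<sigma> [] = 0 \<or> apply_form \<tau> [] = 0" using homogeneous_Nil[OF Nil(1)] homogeneous_Nil[OF Nil(2)] by auto
    then show ?thesis by auto
  qed
next
  case (Cons w ws)
  have "apply_form (\<sigma> * \<tau>) (w # ws) = apply_form (contract w (\<sigma> * \<tau>)) ws"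
    "apply_form (\<tau> * \<sigma>) (w # ws) = apply_form (contract w (\<tau> * \<sigma>)) ws" by simp_all
  then show ?case
    using Cons.IH[OF homogeneous_contract[OF Cons.prems(1)] Cons.prems(2), of w]
      Cons.IH[OF Cons.prems(1) homogeneous_contract[OF Cons.prems(2)], of w] Cons.prems[THEN parity_hom]
    by (auto simp: contract_times powi_neg1)
qed

lemma times_comm: "homogeneous k \<sigma> \<Longrightarrow> homogeneous l \<tau> \<Longrightarrow> \<sigma> * \<tau> = (-1) powi (k * l) *\<^sub>R (\<tau> * \<sigma>)"
  by (rule altform_eqI) (use apply_times_comm in \<open>simp only: apply_form_simps, blast\<close>)

lemma homogeneous_times: assumes "homogeneous k \<sigma>" "homogeneous l \<tau>" shows "homogeneous (k + l + 2) (\<sigma> * \<tau>)"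
proof -
  have "apply_form (\<sigma> * \<tau>) ws = 0" if "int (length ws) \<noteq> k + l + 4" for ws
    using assms that
  proof (induction ws arbitrary: k l \<sigma> \<tau>)
    case Nil
    then have "k \<noteq> -2 \<or> l \<noteq> -2" by auto
    then show ?case using homogeneous_Nil[OF Nil(1)] homogeneous_Nil[OF Nil(2)] by auto
  next
    case (Cons w ws)
    have "apply_form (\<sigma> * \<tau>) (w # ws) = apply_form (contract w (\<sigma> * \<tau>)) ws" by simp
    then show ?case
      using Cons.IH[OF homogeneous_contract[OF Cons.prems(1)] Cons.prems(2), of w] Cons.prems(3)
      Cons.IH[OF Cons.prems(1) homogeneous_contract[OF Cons.prems(2)], of w] Cons.prems(1)[THEN parity_hom]
      by (auto simp: contract_times)
  qed
  then show ?thesis by (auto simp: homogeneous_def)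
qed

text \<open>
  An explicit formula satisfying the axioms, in terms of the basis of $V \oplus V^*$ given by
  \<open>Basis\<close> and its dual basis.
\<close>

definition dbl_basis :: "'a::euclidean_space \<times> bool \<Rightarrow> 'a \<times> 'a dual" where
  "dbl_basis i = (if snd i then (fst i, 0) else (0, blinfun_inner_left (fst i)))"
definition opp :: "'a \<times> bool \<Rightarrow> 'a \<times> bool" where "opp i = (fst i, \<not> snd i)"
definition dbl_index :: "('a::euclidean_space \<times> bool) set" where "dbl_index = Basis \<times> UNIV"

lemma opp_opp [simp]: "opp (opp i) = i" by (simp add: opp_def)
lemma sum_opp: "(\<Sum>i\<in>dbl_index. f (opp i)) = (\<Sum>i\<in>dbl_index. f i)"
  by (rule sum.reindex_bij_witness[of _ opp opp]) (auto simp: dbl_index_def opp_def)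
lemma sum_dbl_index: "(\<Sum>i\<in>dbl_index. f i) = (\<Sum>b\<in>Basis. f (b, True) + f (b, False))"
proof -
  have "(\<Sum>i\<in>dbl_index. f i) = (\<Sum>b\<in>Basis. \<Sum>t\<in>UNIV. f (b, t))"
    unfolding dbl_index_def by (simp add: sum.cartesian_product del: UNIV_bool)
  then show ?thesis by (simp add: UNIV_bool add.commute)
qed

definition bracket_formula :: "'a::euclidean_space dbl \<Rightarrow> 'a dbl \<Rightarrow> 'a dbl" where
  "bracket_formula \<sigma> \<tau> = (\<Sum>i\<in>dbl_index. parity (contract (dbl_basis i) \<sigma>) * contract (dbl_basis (opp i)) \<tau>)"

lemma bilinear_bracket_formula: "bilinear bracket_formula"
  unfolding bilinear_def
  by (auto intro!: linearI simp: bracket_formula_def distrib_left distrib_right sum.distrib scaleR_sum_right)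

lemmas bracket_formula_simps [simp] = bilinear_ladd[OF bilinear_bracket_formula] bilinear_radd[OF bilinear_bracket_formula]
  bilinear_lmul[OF bilinear_bracket_formula] bilinear_rmul[OF bilinear_bracket_formula] bilinear_lneg[OF bilinear_bracket_formula]
  bilinear_rneg[OF bilinear_bracket_formula] bilinear_lzero[OF bilinear_bracket_formula] bilinear_rzero[OF bilinear_bracket_formula]

lemma contract_bracket_formula: "contract w (bracket_formula \<sigma> \<tau>) = bracket_formula (contract w \<sigma>) \<tau> + bracket_formula (parity \<sigma>) (contract w \<tau>)"
proof -
  have "contract w (parity (contract v \<sigma>) * contract v' \<tau>) =
     parity (contract v (contract w \<sigma>)) * contract v' \<tau> +
     parity (contract v (parity \<sigma>)) * contract v' (contract w \<tau>)" for v v'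
    using contract_anticomm[of w v \<sigma>] contract_anticomm[of w v' \<tau>]
    by (simp add: contract_times contract_parity)
  then show ?thesis by (simp add: bracket_formula_def contract_sum sum.distrib)
qed

lemma homogeneous_bracket_formula: assumes "homogeneous k \<sigma>" "homogeneous l \<tau>" shows "homogeneous (k + l) (bracket_formula \<sigma> \<tau>)"
  unfolding bracket_formula_def
proof (rule homogeneous_sum)
  fix i
  have *: "homogeneous (k - 1) (parity (contract (dbl_basis i) \<sigma>))"
    using homogeneous_contract[OF assms(1), of "dbl_basis i"] homogeneous_scale by (metis parity_hom)
  show "homogeneous (k + l) (parity (contract (dbl_basis i) \<sigma>) * contract (dbl_basis (opp i)) \<tau>)"
    using homogeneous_times[OF * homogeneous_contract[OF assms(2)]] by (simp add: algebra_simps)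
qed

lemma bracket_formula_antisym: assumes "homogeneous k \<sigma>" "homogeneous l \<tau>" shows "bracket_formula \<sigma> \<tau> = - ((-1) powi (k * l) *\<^sub>R bracket_formula \<tau> \<sigma>)"
proof -
  have "parity (contract v \<sigma>) * contract v' \<tau> = - ((-1) powi (k * l) *\<^sub>R (parity (contract v' \<tau>) * contract v \<sigma>))" for v v'
    using times_comm[OF homogeneous_contract[OF assms(1)] homogeneous_contract[OF assms(2)], of v v']
    by (auto simp: parity_hom[OF homogeneous_contract[OF assms(1)]] parity_hom[OF homogeneous_contract[OF assms(2)]] powi_neg1)
  then have "bracket_formula \<sigma> \<tau> = (\<Sum>i\<in>dbl_index. - ((-1) powi (k * l) *\<^sub>R (parity (contract (dbl_basis (opp i)) \<tau>) * contract (dbl_basis i) \<sigma>)))"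
    unfolding bracket_formula_def by simp
  also have "\<dots> = - ((-1) powi (k * l) *\<^sub>R (\<Sum>i\<in>dbl_index. (parity (contract (dbl_basis (opp i)) \<tau>) * contract (dbl_basis (opp (opp i))) \<sigma>)))"
    by (simp add: sum_negf scaleR_sum_right)
  also have "(\<Sum>i\<in>dbl_index. (parity (contract (dbl_basis (opp i)) \<tau>) * contract (dbl_basis (opp (opp i))) \<sigma>)) = bracket_formula \<tau> \<sigma>"
    unfolding bracket_formula_def by (rule sum_opp)
  finally show ?thesis .
qed

lemma bracket_formula_deriv: assumes "homogeneous k \<sigma>" "homogeneous l \<tau>"
  shows "bracket_formula \<sigma> (\<tau> * \<rho>) = bracket_formula \<sigma> \<tau> * \<rho> + (-1) powi (k * l) *\<^sub>R (\<tau> * bracket_formula \<sigma> \<rho>)"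
proof -
  have "parity (contract v \<sigma>) * contract v' (\<tau> * \<rho>) =
    parity (contract v \<sigma>) * contract v' \<tau> * \<rho> + (-1) powi (k * l) *\<^sub>R (\<tau> * (parity (contract v \<sigma>) * contract v' \<rho>))" for v v'
  proof -
    have "parity (contract v \<sigma>) * parity \<tau> = (-1) powi (k * l) *\<^sub>R (\<tau> * parity (contract v \<sigma>))"
      using times_comm[OF homogeneous_contract[OF assms(1)] assms(2), of v]
      by (auto simp: parity_hom[OF homogeneous_contract[OF assms(1)]] parity_hom[OF assms(2)] powi_neg1)
    then show ?thesis
      unfolding contract_times distrib_left mult.assoc[symmetric] by simp
  qed
  then show ?thesis
    unfolding bracket_formula_def sum_distrib_left sum_distrib_right scaleR_sum_right sum.distrib[symmetric]
    by (intro sum.cong refl)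
qed

lemma bracket_formula_Nil: "apply_form (bracket_formula \<sigma> \<tau>) [] = (\<Sum>i\<in>dbl_index. apply_form \<sigma> [dbl_basis i] * apply_form \<tau> [dbl_basis (opp i)])"
  by (simp add: bracket_formula_def apply_form_sum)

lemma apply_swap: "apply_form \<sigma> (v # w # us) = - apply_form \<sigma> (w # v # us)"
  using arg_cong[OF contract_anticomm[of w v \<sigma>], of "\<lambda>x. apply_form x us"] by simp

lemma bracket_formula_single: "apply_form (bracket_formula \<sigma> \<tau>) [w] =
  (\<Sum>i\<in>dbl_index. apply_form \<sigma> [w, dbl_basis i] * apply_form \<tau> [dbl_basis (opp i)] - apply_form \<sigma> [dbl_basis i] * apply_form \<tau> [w, dbl_basis (opp i)])"
proof -
  have "apply_form (bracket_formula \<sigma> \<tau>) [w] = apply_form (contract w (bracket_formula \<sigma> \<tau>)) []" by simp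
  also have "\<dots> = (\<Sum>i\<in>dbl_index. apply_form \<sigma> [w, dbl_basis i] * apply_form \<tau> [dbl_basis (opp i)] - apply_form \<sigma> [dbl_basis i] * apply_form \<tau> [w, dbl_basis (opp i)])"
    unfolding contract_bracket_formula apply_form_simps bracket_formula_Nil
    by (simp add: sum_subtractf sum_negf)
  finally show ?thesis .
qed

lemma bracket_formula_jacobi_aux:
  assumes "homogeneous k \<sigma>" "homogeneous l \<tau>"
  shows "apply_form (bracket_formula \<sigma> (bracket_formula \<tau> \<rho>)) ws =
    apply_form (bracket_formula (bracket_formula \<sigma> \<tau>) \<rho>) ws + (-1) powi (k * l) * apply_form (bracket_formula \<tau> (bracket_formula \<sigma> \<rho>)) ws"
  using assms
proof (induction ws arbitrary: k l \<sigma> \<tau> \<rho>)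
  case Nil
  let ?S = "\<lambda>i. apply_form \<sigma> [dbl_basis i]" and ?T = "\<lambda>i. apply_form \<tau> [dbl_basis i]" and ?R = "\<lambda>i. apply_form \<rho> [dbl_basis i]"
  let ?S2 = "\<lambda>i j. apply_form \<sigma> [dbl_basis i, dbl_basis j]" and ?T2 = "\<lambda>i j. apply_form \<tau> [dbl_basis i, dbl_basis j]" and ?R2 = "\<lambda>i j. apply_form \<rho> [dbl_basis i, dbl_basis j]"
  let ?s = "(-1::real) powi (k * l)"
  define X1 where "X1 = (\<Sum>i\<in>dbl_index. \<Sum>j\<in>dbl_index. ?S i * ?T2 (opp i) j * ?R (opp j))"
  define X2 where "X2 = (\<Sum>i\<in>dbl_index. \<Sum>j\<in>dbl_index. ?S i * ?T j * ?R2 (opp i) (opp j))"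
  define X3 where "X3 = (\<Sum>i\<in>dbl_index. \<Sum>j\<in>dbl_index. ?T i * ?S2 (opp i) j * ?R (opp j))"
  have sw: "?S2 i j = - ?S2 j i" "?T2 i j = - ?T2 j i" "?R2 i j = - ?R2 j i" for i j
    using apply_swap by blast+
  have A: "apply_form (bracket_formula \<sigma> (bracket_formula \<tau> \<rho>)) [] = X1 - X2"
    unfolding X1_def X2_def bracket_formula_Nil bracket_formula_single
    by (simp add: sum_distrib_left sum_subtractf algebra_simps)
  have B: "apply_form (bracket_formula \<tau> (bracket_formula \<sigma> \<rho>)) [] = X3 + X2"
  proof -
    have "(\<Sum>i\<in>dbl_index. \<Sum>j\<in>dbl_index. ?T i * ?S j * ?R2 (opp i) (opp j)) = - X2"
      unfolding X2_def
      by (subst sum.swap, subst sw(3)) (simp add: sum_negf algebra_simps)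
    then show ?thesis
      unfolding X3_def bracket_formula_Nil bracket_formula_single
      by (simp add: sum_distrib_left sum_subtractf algebra_simps)
  qed
  have C: "apply_form (bracket_formula (bracket_formula \<sigma> \<tau>) \<rho>) [] = X1 - X3"
  proof -
    have 1: "(\<Sum>j\<in>dbl_index. \<Sum>i\<in>dbl_index. ?S2 j i * ?T (opp i) * ?R (opp j)) = - X3"
      unfolding X3_def
      using sum_opp[of "\<lambda>i. \<Sum>j\<in>dbl_index. ?S2 j i * ?T (opp i) * ?R (opp j)", symmetric]
      by (subst sum.swap, subst (asm) (2) sw(1)) (simp add: sum_negf algebra_simps)
    have 2: "(\<Sum>j\<in>dbl_index. \<Sum>i\<in>dbl_index. ?S i * ?T2 j (opp i) * ?R (opp j)) = - X1"
      unfolding X1_def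
      by (subst sum.swap, subst sw(2)) (simp add: sum_negf algebra_simps)
    show ?thesis
      unfolding bracket_formula_Nil bracket_formula_single sum_distrib_right left_diff_distrib sum_subtractf 1 2 by simp
  qed
  have "X2 = 0" if "\<not> (k = -1 \<and> l = -1)"
  proof -
    have "(\<forall>i. ?S i = 0) \<or> (\<forall>i. ?T i = 0)" using that homogeneous_single[OF Nil(1)] homogeneous_single[OF Nil(2)] by metis
    then show ?thesis unfolding X2_def by (elim disjE) (simp_all del: split_paired_All)
  qed
  moreover have "X3 = 0" if "\<not> (k = 0 \<and> l = -1)"
  proof -
    have "(\<forall>i j. ?S2 i j = 0) \<or> (\<forall>i. ?T i = 0)" using that homogeneous_pair[OF Nil(1)] homogeneous_single[OF Nil(2)] by metis
    then show ?thesis unfolding X3_def by (elim disjE) (simp_all del: split_paired_All)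
  qed
  ultimately show ?case unfolding A B C by fastforce
next
  case (Cons w ws)
  have *: "apply_form \<sigma> (w # ws) = apply_form (contract w \<sigma>) ws" for \<sigma> by simp
  note hc = homogeneous_contract
  show ?case
    using Cons.IH[OF hc[OF Cons.prems(1)] Cons.prems(2), of w \<rho>] Cons.IH[OF Cons.prems(1) hc[OF Cons.prems(2)], of w \<rho>]
      Cons.IH[OF Cons.prems, of "contract w \<rho>"]
    unfolding * contract_bracket_formula
    by (auto simp: parity_hom[OF Cons.prems(1)] parity_hom[OF Cons.prems(2)] parity_hom[OF homogeneous_bracket_formula[OF Cons.prems]] 
      powi_neg1 algebra_simps)
qed

lemma bracket_formula_jacobi:
  assumes "homogeneous k \<sigma>" "homogeneous l \<tau>"
  shows "bracket_formula \<sigma> (bracket_formula \<tau> \<rho>) = bracket_formula (bracket_formula \<sigma> \<tau>) \<rho> + (-1) powi (k * l) *\<^sub>R bracket_formula \<tau> (bracket_formula \<sigma> \<rho>)"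
  by (rule altform_eqI) (simp add: bracket_formula_jacobi_aux[OF assms])

lemma bracket_formula_one [simp]: "bracket_formula 1 \<sigma> = 0" "bracket_formula \<sigma> 1 = 0" by (simp_all add: bracket_formula_def)

lemma bracket_formula_gen:
  "bracket_formula (of_vec x) (of_vec y) = 0" "bracket_formula (of_covec \<alpha>) (of_covec \<beta>) = 0"
  "bracket_formula (of_vec x) (of_covec \<alpha>) = of_real (blinfun_apply \<alpha> x)"
proof -
  have "(\<Sum>b\<in>Basis. (x \<bullet> b) *\<^sub>R blinfun_apply \<alpha> b) = blinfun_apply \<alpha> (\<Sum>b\<in>Basis. (x \<bullet> b) *\<^sub>R b)"
    by (simp add: blinfun.sum_right blinfun.scaleR_right)
  then have "(\<Sum>b\<in>Basis. (x \<bullet> b) * blinfun_apply \<alpha> b) = blinfun_apply \<alpha> x"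
    by (simp add: euclidean_representation)
  then show "bracket_formula (of_vec x) (of_covec \<alpha>) = of_real (blinfun_apply \<alpha> x)"
    by (simp add: bracket_formula_def sum_dbl_index dbl_basis_def opp_def of_real_def mult.commute flip: scaleR_sum_left)
qed (simp_all add: bracket_formula_def sum_dbl_index dbl_basis_def opp_def)

lemma bidegree_prodI:
  "int (length \<alpha>s) = q + 1 \<Longrightarrow> int (length vs) = p + 1 \<Longrightarrow>
   prod_list (map of_covec \<alpha>s) * prod_list (map of_vec vs) \<in> bidegree p q"
  unfolding bidegree_def by (rule span_base) blast

lemma subspace_bidegree: "subspace (bidegree p q)" unfolding bidegree_def by simp
lemma subspace_total_degree: "subspace (total_degree k)" unfolding total_degree_def by simp

lemma bidegree_induct [consumes 1, case_names prod zero add scale]: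
  assumes "\<sigma> \<in> bidegree p q"
    and "\<And>\<alpha>s vs. int (length \<alpha>s) = q + 1 \<Longrightarrow> int (length vs) = p + 1 \<Longrightarrow>
       P (prod_list (map of_covec \<alpha>s) * prod_list (map of_vec vs))"
    and "P 0" "\<And>x y. P x \<Longrightarrow> P y \<Longrightarrow> P (x + y)" "\<And>c x. P x \<Longrightarrow> P (c *\<^sub>R x)"
  shows "P \<sigma>"
  using assms(1) unfolding bidegree_def
  by (rule span_induct) (use assms(2-) in \<open>auto simp: subspace_def\<close>)

lemma homogeneous_prod_list: "(\<And>x. x \<in> set xs \<Longrightarrow> homogeneous (-1) x) \<Longrightarrow> homogeneous (int (length xs) - 2) (prod_list xs)"
proof (induction xs)
  case Nil show ?case using homogeneous_one by simp
next
  case (Cons x xs)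
  then have "homogeneous (-1 + (int (length xs) - 2) + 2) (x * prod_list xs)" by (intro homogeneous_times) auto
  then show ?case by (simp add: algebra_simps)
qed

lemma homogeneous_vecs: "homogeneous (int (length vs) - 2) (prod_list (map of_vec vs))"
  using homogeneous_prod_list[of "map of_vec vs"] homogeneous_of_vec by fastforce
lemma homogeneous_covecs: "homogeneous (int (length vs) - 2) (prod_list (map of_covec vs))"
  using homogeneous_prod_list[of "map of_covec vs"] homogeneous_of_covec by fastforce

lemma homogeneous_bidegree: "\<sigma> \<in> bidegree p q \<Longrightarrow> homogeneous (p + q) \<sigma>"
proof (induction rule: bidegree_induct)
  case (prod \<alpha>s vs)
  have "homogeneous (int (length (map of_covec \<alpha>s)) - 2 + (int (length (map of_vec vs)) - 2) + 2)
    (prod_list (map of_covec \<alpha>s) * prod_list (map of_vec vs))"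
    by (intro homogeneous_times homogeneous_prod_list) (auto simp: homogeneous_of_vec homogeneous_of_covec)
  with prod show ?case by (simp add: add.commute)
qed (auto intro: homogeneous_add homogeneous_scale)

lemma homogeneous_total_degree: "\<sigma> \<in> total_degree k \<Longrightarrow> homogeneous k \<sigma>"
  unfolding total_degree_def
  by (erule span_induct)
     (auto simp: subspace_def intro: homogeneous_add homogeneous_scale split: if_splits dest: homogeneous_bidegree)

lemma bidegree_total_degree: "\<sigma> \<in> bidegree p q \<Longrightarrow> p + q = k \<Longrightarrow> \<sigma> \<in> total_degree k"
  unfolding total_degree_def by (rule span_base) auto

lemma prod_list_of_covec_bidegree: "prod_list (map of_covec \<alpha>s) \<in> bidegree (-1) (int (length \<alpha>s) - 1)"
  using bidegree_prodI[of \<alpha>s _ "[]"] by simp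
lemma prod_list_of_vec_bidegree: "prod_list (map of_vec \<alpha>s) \<in> bidegree (int (length \<alpha>s) - 1) (-1)"
  using bidegree_prodI[of "[]" _ \<alpha>s] by simp
lemma one_bidegree: "1 \<in> bidegree (-1) (-1)" using bidegree_prodI[of "[]" "-1" "[]" "-1"] by simp
lemma of_vec_bidegree: "of_vec x \<in> bidegree 0 (-1)" using bidegree_prodI[of "[]" "-1" "[x]" 0] by simp
lemma of_covec_bidegree: "of_covec x \<in> bidegree (-1) 0" using bidegree_prodI[of "[x]" 0 "[]" "-1"] by simp

lemma times_bidegree:
  assumes "\<sigma> \<in> bidegree p q" "\<tau> \<in> bidegree p' q'"
  shows "\<sigma> * \<tau> \<in> bidegree (p + p' + 1) (q + q' + 1)"
  using assms(1)
proof (induction rule: bidegree_induct)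
  case (prod \<alpha>s vs)
  show ?case using assms(2)
  proof (induction rule: bidegree_induct)
    case (prod \<beta>s ws)
    let ?c = "\<lambda>xs. prod_list (map of_covec xs)" and ?v = "\<lambda>xs. prod_list (map of_vec xs)"
    have e: "?v vs * ?c \<beta>s = (-1) powi ((int (length vs) - 2) * (int (length \<beta>s) - 2)) *\<^sub>R (?c \<beta>s * ?v vs)"
      by (intro times_comm homogeneous_vecs homogeneous_covecs)
    have *: "?c \<alpha>s * ?v vs * (?c \<beta>s * ?v ws) = (-1) powi ((int (length vs) - 2) * (int (length \<beta>s) - 2)) *\<^sub>R
      (?c (\<alpha>s @ \<beta>s) * ?v (vs @ ws))"
    proof -
      have "?c \<alpha>s * ?v vs * (?c \<beta>s * ?v ws) = ?c \<alpha>s * (?v vs * ?c \<beta>s) * ?v ws" by (simp only: mult.assoc)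
      then show ?thesis unfolding e by (simp add: mult.assoc)
    qed
    show ?case unfolding * 
      by (intro subspace_scale[OF subspace_bidegree] bidegree_prodI) (use \<open>int (length \<alpha>s) = q + 1\<close>
         \<open>int (length vs) = p + 1\<close> prod in auto)
  qed (auto simp: distrib_left subspace_0[OF subspace_bidegree] subspace_add[OF subspace_bidegree] 
     subspace_scale[OF subspace_bidegree])
qed (auto simp: distrib_right subspace_0[OF subspace_bidegree] subspace_add[OF subspace_bidegree] 
     subspace_scale[OF subspace_bidegree])

lemma parity_bidegree: "\<sigma> \<in> bidegree p q \<Longrightarrow> parity \<sigma> \<in> bidegree p q"
  using parity_hom[OF homogeneous_bidegree] subspace_scale[OF subspace_bidegree] by metis

lemma scale_one_bidegree: "c *\<^sub>R 1 \<in> bidegree (-1) (-1)"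
  by (intro subspace_scale[OF subspace_bidegree] one_bidegree)

lemma contract_prod_of_vec:
  "contract (x, 0) (prod_list (map of_vec vs)) = 0"
  "contract (0, \<phi>) (prod_list (map of_vec vs)) \<in> bidegree (int (length vs) - 2) (-1)"
proof (induction vs)
  case (Cons v vs)
  { case 1 show ?case using Cons by (simp add: contract_times) }
  { case 2
    have "(blinfun_apply \<phi> v *\<^sub>R 1) * prod_list (map of_vec vs) \<in> bidegree (-1 + (int (length vs) - 1) + 1) (-1 + -1 + 1)"
      by (intro times_bidegree scale_one_bidegree prod_list_of_vec_bidegree)
    moreover have "(- of_vec v) * contract (0, \<phi>) (prod_list (map of_vec vs)) \<in> bidegree (0 + (int (length vs) - 2) + 1) (-1 + -1 + 1)"
      by (intro times_bidegree subspace_neg[OF subspace_bidegree] of_vec_bidegree Cons)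
    ultimately show ?case
      using subspace_add[OF subspace_bidegree] by (fastforce simp: contract_times) }
qed (auto simp: subspace_0[OF subspace_bidegree])

lemma contract_prod_of_covec:
  "contract (0, \<phi>) (prod_list (map of_covec vs)) = 0"
  "contract (x, 0) (prod_list (map of_covec vs)) \<in> bidegree (-1) (int (length vs) - 2)"
proof (induction vs)
  case (Cons v vs)
  { case 1 show ?case using Cons by (simp add: contract_times) }
  { case 2
    have "(blinfun_apply v x *\<^sub>R 1) * prod_list (map of_covec vs) \<in> bidegree (-1 + -1 + 1) (-1 + (int (length vs) - 1) + 1)"
      by (intro times_bidegree scale_one_bidegree prod_list_of_covec_bidegree)
    moreover have "(- of_covec v) * contract (x, 0) (prod_list (map of_covec vs)) \<in> bidegree (-1 + -1 + 1) (0 + (int (length vs) - 2) + 1)"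
      by (intro times_bidegree subspace_neg[OF subspace_bidegree] of_covec_bidegree Cons)
    ultimately show ?case
      using subspace_add[OF subspace_bidegree] by (fastforce simp: contract_times) }
qed (auto simp: subspace_0[OF subspace_bidegree])

lemma contract_bidegree:
  assumes "\<sigma> \<in> bidegree p q"
  shows "contract (x, 0) \<sigma> \<in> bidegree p (q - 1)" "contract (0, \<phi>) \<sigma> \<in> bidegree (p - 1) q"
proof -
  note sub = subspace_0[OF subspace_bidegree] subspace_add[OF subspace_bidegree] subspace_scale[OF subspace_bidegree]
  show "contract (x, 0) \<sigma> \<in> bidegree p (q - 1)" using assms
  proof (induction rule: bidegree_induct)
    case (prod \<alpha>s vs)
    show ?case
      using times_bidegree[OF contract_prod_of_covec(2)[of x \<alpha>s] prod_list_of_vec_bidegree[of vs]] prod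
      by (simp add: contract_times contract_prod_of_vec algebra_simps)
  qed (auto intro: sub)
  show "contract (0, \<phi>) \<sigma> \<in> bidegree (p - 1) q" using assms
  proof (induction rule: bidegree_induct)
    case (prod \<alpha>s vs)
    show ?case
      using times_bidegree[OF parity_bidegree[OF prod_list_of_covec_bidegree[of \<alpha>s]] contract_prod_of_vec(2)[of \<phi> vs]] prod
      by (simp add: contract_times contract_prod_of_covec algebra_simps)
  qed (auto intro: sub)
qed

lemma bracket_formula_bidegree:
  assumes "\<sigma> \<in> bidegree p q" "\<tau> \<in> bidegree p' q'"
  shows "bracket_formula \<sigma> \<tau> \<in> bidegree (p + p') (q + q')"
  unfolding bracket_formula_def
proof (rule subspace_sum[OF subspace_bidegree])
  fix i :: "'a \<times> bool"
  show "parity (contract (dbl_basis i) \<sigma>) * contract (dbl_basis (opp i)) \<tau> \<in> bidegree (p + p') (q + q')"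
    using times_bidegree[OF parity_bidegree[OF contract_bidegree(1)[OF assms(1)]] contract_bidegree(2)[OF assms(2)], of "fst i" "blinfun_inner_left (fst i)"]
     times_bidegree[OF parity_bidegree[OF contract_bidegree(2)[OF assms(1)]] contract_bidegree(1)[OF assms(2)], of "blinfun_inner_left (fst i)" "fst i"]
    by (cases i; cases "snd i") (auto simp: dbl_basis_def opp_def algebra_simps)
qed

lemma is_big_bracket_bracket_formula: "is_big_bracket bracket_formula"
  unfolding is_big_bracket_def
proof (intro conjI allI ballI)
  fix \<sigma> \<tau> \<rho> :: "'a dbl" and k k' :: int
  assume *: "\<sigma> \<in> total_degree k" "\<tau> \<in> total_degree k'"
  note h = *[THEN homogeneous_total_degree]
  show "bracket_formula \<sigma> \<tau> = - ((-1) powi (k * k') *\<^sub>R bracket_formula \<tau> \<sigma>)" by (rule bracket_formula_antisym[OF h])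
  show "bracket_formula \<sigma> (bracket_formula \<tau> \<rho>) = bracket_formula (bracket_formula \<sigma> \<tau>) \<rho> + (-1) powi (k * k') *\<^sub>R bracket_formula \<tau> (bracket_formula \<sigma> \<rho>)"
    by (rule bracket_formula_jacobi[OF h])
  show "bracket_formula \<sigma> (\<tau> * \<rho>) = bracket_formula \<sigma> \<tau> * \<rho> + (-1) powi (k * k') *\<^sub>R (\<tau> * bracket_formula \<sigma> \<rho>)"
    by (rule bracket_formula_deriv[OF h])
qed (simp_all add: bilinear_bracket_formula bracket_formula_bidegree bracket_formula_gen of_real_def)

definition gens :: "'a::real_normed_vector dbl set" where
  "gens = range of_vec \<union> range of_covec"

lemma euler_dbl_index:
  fixes w :: "'a::euclidean_space \<times> 'a dual"
  shows "(\<Sum>i\<in>dbl_index. apply_form (if snd i then of_covec (blinfun_inner_left (fst i)) else of_vec (fst i)) [w] *\<^sub>R dbl_basis i) = w"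
proof -
  obtain x \<phi> where w: "w = (x, \<phi>)" by force
  have "(\<Sum>b\<in>Basis. blinfun_apply \<phi> b *\<^sub>R blinfun_inner_left b) = \<phi>"
  proof (rule blinfun_eqI)
    fix y
    have "(\<Sum>b\<in>Basis. blinfun_apply \<phi> b * (y \<bullet> b)) = blinfun_apply \<phi> (\<Sum>b\<in>Basis. (y \<bullet> b) *\<^sub>R b)"
      by (simp add: blinfun.sum_right blinfun.scaleR_right mult.commute)
    then show "blinfun_apply (\<Sum>b\<in>Basis. blinfun_apply \<phi> b *\<^sub>R blinfun_inner_left b) y = blinfun_apply \<phi> y"
      by (simp add: blinfun.sum_left blinfun.scaleR_left euclidean_representation)
  qed
  then show ?thesis
    by (simp add: sum_dbl_index dbl_basis_def apply_of_vec apply_of_covec w sum.distrib sum_prod euclidean_representation)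
qed

definition gform :: "'a::euclidean_space \<times> bool \<Rightarrow> 'a dbl" where
  "gform i = (if snd i then of_covec (blinfun_inner_left (fst i)) else of_vec (fst i))"

lemma gform_simps: "contract w (gform i) = apply_form (gform i) [w] *\<^sub>R 1" "parity (gform i) = - gform i"
  by (cases w; auto simp: gform_def apply_of_vec apply_of_covec)+

definition euler :: "'a::euclidean_space dbl \<Rightarrow> 'a dbl" where
  "euler \<sigma> = (\<Sum>i\<in>dbl_index. gform i * contract (dbl_basis i) \<sigma>)"

lemma contract_euler: "contract w (euler \<sigma>) = contract w \<sigma> + euler (contract w \<sigma>)"
proof -
  have "contract w (gform i * contract (dbl_basis i) \<sigma>) = 
     contract (apply_form (gform i) [w] *\<^sub>R dbl_basis i) \<sigma> + gform i * contract (dbl_basis i) (contract w \<sigma>)" for i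
    using contract_anticomm[of w "dbl_basis i" \<sigma>]
    by (simp add: contract_times gform_simps contract_left_simps)
  then have "contract w (euler \<sigma>) = contract (\<Sum>i\<in>dbl_index. apply_form (gform i) [w] *\<^sub>R dbl_basis i) \<sigma> + euler (contract w \<sigma>)"
    unfolding euler_def contract_sum linear_sum[OF linear_contract_left] by (simp add: sum.distrib)
  then show ?thesis using euler_dbl_index[of w] unfolding gform_def by simp
qed

lemma apply_euler: "apply_form (euler \<sigma>) ws = real (length ws) * apply_form \<sigma> ws"
proof (induction ws arbitrary: \<sigma>)
  case Nil show ?case by (auto simp: euler_def apply_form_sum gform_def intro!: sum.neutral)
next
  case (Cons w ws)
  have "apply_form (euler \<sigma>) (w # ws) = apply_form (contract w (euler \<sigma>)) ws" by simp
  then show ?case unfolding contract_euler by (simp add: Cons algebra_simps)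
qed

definition gspan :: "'a::real_normed_vector dbl set" where
  "gspan = span {prod_list xs |xs. set xs \<subseteq> gens}"

lemma subspace_gspan: "subspace gspan" unfolding gspan_def by simp

lemma gens_times_gspan:
  assumes "g \<in> gens" "\<sigma> \<in> gspan" shows "g * \<sigma> \<in> gspan"
  using assms(2) unfolding gspan_def
proof (induction rule: span_induct_alt)
  case (step c x y)
  then obtain xs where "x = prod_list xs" "set xs \<subseteq> gens" by auto
  then have "g * x \<in> span {prod_list xs |xs. set xs \<subseteq> gens}"
    using assms(1) by (intro span_base CollectI exI[of _ "g # xs"]) auto
  with step show ?case by (auto simp: distrib_left intro: span_add span_scale)
qed (auto simp: span_zero)

lemma homogeneous_gspan: "homogeneous (int n - 2) \<sigma> \<Longrightarrow> (\<sigma>::'a::euclidean_space dbl) \<in> gspan"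
proof (induction n arbitrary: \<sigma>)
  case 0
  have e: "apply_form \<sigma> [] *\<^sub>R prod_list [] = \<sigma>"
    using 0 by (intro altform_eqI) (auto simp: homogeneous_def)
  have "(prod_list [] :: 'a dbl) \<in> gspan" unfolding gspan_def by (intro span_base) (auto intro!: exI[of _ "[]"])
  from subspace_scale[OF subspace_gspan this, of "apply_form \<sigma> []"] show ?case unfolding e .
next
  case (Suc n)
  have E: "euler \<sigma> \<in> gspan"
    unfolding euler_def gspan_def
  proof (intro span_sum)
    fix i :: "'a \<times> bool"
    have "contract (dbl_basis i) \<sigma> \<in> gspan"
      using homogeneous_contract[OF Suc.prems] by (intro Suc.IH) (simp add: algebra_simps)
    then show "gform i * contract (dbl_basis i) \<sigma> \<in> span {prod_list xs |xs. set xs \<subseteq> gens}"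
      using gens_times_gspan[of "gform i"] by (auto simp: gspan_def gens_def gform_def)
  qed
  have e: "(1 / real (Suc n)) *\<^sub>R euler \<sigma> = \<sigma>"
  proof (rule altform_eqI)
    fix ws
    show "apply_form ((1 / real (Suc n)) *\<^sub>R euler \<sigma>) ws = apply_form \<sigma> ws"
      using Suc.prems by (cases "length ws = Suc n") (auto simp: apply_euler homogeneous_def)
  qed
  from subspace_scale[OF subspace_gspan E, of "1 / real (Suc n)"] show ?case unfolding e .
qed

lift_definition graded_part :: "nat \<Rightarrow> 'w::real_vector altform \<Rightarrow> 'w altform" is
  "\<lambda>n f ws. if length ws = n then f ws else 0"
proof -
  fix n and f :: "'w list \<Rightarrow> real" assume f: "alternating f"
  have "linear (\<lambda>w. if length (us @ w # vs) = n then f (us @ w # vs) else 0)" for us vs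
    using f by (cases "length us + Suc (length vs) = n") (auto simp: alternating_def linear_iff)
  then show "alternating (\<lambda>ws. if length ws = n then f ws else 0)"
    using f unfolding alternating_def by auto
qed

lemma gspan_UNIV: "(\<sigma>::'a::euclidean_space dbl) \<in> gspan"
proof -
  have c: "apply_form (graded_part n \<sigma>) ws = (if length ws = n then apply_form \<sigma> ws else 0)" for n ws
    by transfer simp
  obtain N where N: "\<And>ws. N < length ws \<Longrightarrow> apply_form \<sigma> ws = 0"
    using apply_form[of \<sigma>] by (auto simp: alternating_def)
  have e: "(\<Sum>n\<le>N. graded_part n \<sigma>) = \<sigma>"
    by (rule altform_eqI) (use N in \<open>auto simp: apply_form_sum c not_le\<close>)
  have "graded_part n \<sigma> \<in> gspan" for n
    by (rule homogeneous_gspan[of n]) (auto simp: homogeneous_def c)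
  then have "(\<Sum>n\<le>N. graded_part n \<sigma>) \<in> gspan" by (intro subspace_sum[OF subspace_gspan])
  then show ?thesis unfolding e .
qed

lemma bilinear_eq_gens:
  fixes B C :: "'a::euclidean_space dbl \<Rightarrow> 'a dbl \<Rightarrow> 'a dbl"
  assumes "bilinear B" "bilinear C"
    "\<And>xs ys. set xs \<subseteq> gens \<Longrightarrow> set ys \<subseteq> gens \<Longrightarrow> B (prod_list xs) (prod_list ys) = C (prod_list xs) (prod_list ys)"
  shows "B = C"
proof (intro ext)
  fix \<sigma> \<tau> :: "'a dbl"
  show "B \<sigma> \<tau> = C \<sigma> \<tau>"
    by (rule bilinear_eq[OF assms(1,2), of UNIV "{prod_list xs |xs. set xs \<subseteq> gens}" UNIV "{prod_list xs |xs. set xs \<subseteq> gens}"])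
      (use gspan_UNIV assms(3) in \<open>auto simp: gspan_def\<close>)
qed

lemma prod_gens_total_degree: "set xs \<subseteq> gens \<Longrightarrow> \<exists>p q. p + q = int (length xs) - 2 \<and> prod_list xs \<in> bidegree p q"
proof (induction xs)
  case Nil then show ?case using one_bidegree by (intro exI[of _ "-1"]) auto
next
  case (Cons x xs)
  then obtain p q where pq: "p + q = int (length xs) - 2" "prod_list xs \<in> bidegree p q" by auto
  from Cons.prems consider v where "x = of_vec v" | v where "x = of_covec v" by (auto simp: gens_def)
  then show ?case
  proof cases
    case 1
    then have "prod_list (x # xs) \<in> bidegree (0 + p + 1) (-1 + q + 1)"
      using times_bidegree[OF of_vec_bidegree pq(2)] by simp
    with pq show ?thesis by (intro exI[of _ "0 + p + 1"] exI[of _ "-1 + q + 1"]) auto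
  next
    case 2
    then have "prod_list (x # xs) \<in> bidegree (-1 + p + 1) (0 + q + 1)"
      using times_bidegree[OF of_covec_bidegree pq(2)] by simp
    with pq show ?thesis by (intro exI[of _ "-1 + p + 1"] exI[of _ "0 + q + 1"]) auto
  qed
qed

lemma is_big_bracket_unique:
  fixes B C :: "'a::euclidean_space dbl \<Rightarrow> 'a dbl \<Rightarrow> 'a dbl"
  assumes "is_big_bracket B" "is_big_bracket C"
  shows "B = C"
proof -
  have deg: "prod_list xs \<in> total_degree (int (length xs) - 2)" if "set xs \<subseteq> gens" for xs :: "'a dbl list"
    using prod_gens_total_degree[OF that] bidegree_total_degree by blast
  have deg1: "x \<in> total_degree (-1)" if "x \<in> gens" for x :: "'a dbl"
    using deg[of "[x]"] that by simp
  have one: "D \<sigma> 1 = 0" if "is_big_bracket D" "\<sigma> \<in> total_degree k" for D :: "'a dbl \<Rightarrow> 'a dbl \<Rightarrow> 'a dbl" and \<sigma> k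
  proof -
    have "(1 :: 'a dbl) \<in> total_degree (-2)" using deg[of "[]"] by simp
    with that have "D \<sigma> (1 * 1) = D \<sigma> 1 * 1 + (-1) powi (k * (-2)) *\<^sub>R (1 * D \<sigma> 1)"
      unfolding is_big_bracket_def by blast
    then show ?thesis by (simp add: powi_neg1)
  qed
  have vc: "D (of_vec x) (of_vec y) = 0" "D (of_covec \<alpha>) (of_covec \<beta>) = 0"
     "D (of_vec x) (of_covec \<alpha>) = of_real (blinfun_apply \<alpha> x)" if "is_big_bracket D" for D :: "'a dbl \<Rightarrow> 'a dbl \<Rightarrow> 'a dbl" and x y \<alpha> \<beta>
  proof -
    have "D (of_real 0 + of_vec x) (of_real 0 + of_vec y) = 0" "D (of_real 0 + of_covec \<alpha>) (of_real 0 + of_covec \<beta>) = 0"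
      using that unfolding is_big_bracket_def by blast+
    then show "D (of_vec x) (of_vec y) = 0" "D (of_covec \<alpha>) (of_covec \<beta>) = 0" by simp_all
    show "D (of_vec x) (of_covec \<alpha>) = of_real (blinfun_apply \<alpha> x)"
      using that unfolding is_big_bracket_def by blast
  qed
  have anti: "D \<sigma> \<tau> = - ((-1) powi (k * l) *\<^sub>R D \<tau> \<sigma>)"
    if "is_big_bracket D" "\<sigma> \<in> total_degree k" "\<tau> \<in> total_degree l" for D :: "'a dbl \<Rightarrow> 'a dbl \<Rightarrow> 'a dbl" and \<sigma> \<tau> k l
  proof -
    from that(1) have "\<forall>k k'. \<forall>\<sigma>\<in>total_degree k. \<forall>\<tau>\<in>total_degree k'. D \<sigma> \<tau> = - ((-1) powi (k * k') *\<^sub>R D \<tau> \<sigma>)"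
      unfolding is_big_bracket_def by (elim conjE)
    from this[rule_format, OF that(2,3)] show ?thesis .
  qed
  have der: "D \<sigma> (\<tau> * \<rho>) = D \<sigma> \<tau> * \<rho> + (-1) powi (k * l) *\<^sub>R (\<tau> * D \<sigma> \<rho>)"
    if "is_big_bracket D" "\<sigma> \<in> total_degree k" "\<tau> \<in> total_degree l" for D :: "'a dbl \<Rightarrow> 'a dbl \<Rightarrow> 'a dbl" and \<sigma> \<tau> \<rho> k l
  proof -
    from that(1) have "\<forall>k k'. \<forall>\<sigma>\<in>total_degree k. \<forall>\<tau>\<in>total_degree k'. \<forall>\<rho>.
        D \<sigma> (\<tau> * \<rho>) = D \<sigma> \<tau> * \<rho> + (-1) powi (k * k') *\<^sub>R (\<tau> * D \<sigma> \<rho>)"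
      unfolding is_big_bracket_def by (elim conjE)
    from this[rule_format, OF that(2,3)] show ?thesis .
  qed
  have cv: "D (of_covec \<alpha>) (of_vec x) = of_real (blinfun_apply \<alpha> x)" if "is_big_bracket D" for D :: "'a dbl \<Rightarrow> 'a dbl \<Rightarrow> 'a dbl" and x \<alpha>
    using anti[OF that deg1 deg1, of "of_covec \<alpha>" "of_vec x"] vc[OF that] by (simp add: gens_def)
  have g: "B x y = C x y" if "x \<in> gens" "y \<in> gens" for x y
    using that vc[OF assms(1)] vc[OF assms(2)] cv[OF assms(1)] cv[OF assms(2)] by (auto simp: gens_def)
  have step: "B \<sigma> (prod_list ys) = C \<sigma> (prod_list ys)"
    if "\<sigma> \<in> total_degree k" "set ys \<subseteq> gens" "\<And>y. y \<in> gens \<Longrightarrow> B \<sigma> y = C \<sigma> y" for \<sigma> k ys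
    using that(2)
  proof (induction ys)
    case Nil then show ?case using one[OF assms(1) that(1)] one[OF assms(2) that(1)] by simp
  next
    case (Cons y ys)
    have "D \<sigma> (y * prod_list ys) = D \<sigma> y * prod_list ys + (-1) powi (k * (-1)) *\<^sub>R (y * D \<sigma> (prod_list ys))"
      if "is_big_bracket D" for D :: "'a dbl \<Rightarrow> 'a dbl \<Rightarrow> 'a dbl"
      using Cons.prems by (intro der[OF that \<open>\<sigma> \<in> total_degree k\<close> deg1]) simp
    from this[OF assms(1)] this[OF assms(2)] show ?case
      using Cons that(3) by simp
  qed
  have step2: "B x (prod_list ys) = C x (prod_list ys)" if "x \<in> gens" "set ys \<subseteq> gens" for x ys
    using step[OF deg1] g that by blast
  have step3: "B (prod_list ys) x = C (prod_list ys) x" if "x \<in> gens" "set ys \<subseteq> gens" for x ys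
    using anti[OF assms(1) deg[OF that(2)] deg1[OF that(1)]] anti[OF assms(2) deg[OF that(2)] deg1[OF that(1)]]
      step2[OF that] by simp
  show ?thesis
  proof (rule bilinear_eq_gens)
    show "bilinear B" "bilinear C" using assms unfolding is_big_bracket_def by blast+
  qed (use step step3 deg in blast)
qed

theorem big_bracket_eq: "big_bracket = bracket_formula"
  unfolding big_bracket_def using is_big_bracket_bracket_formula is_big_bracket_unique by blast

theorem is_big_bracket_big_bracket: "is_big_bracket (big_bracket :: 'a::euclidean_space dbl \<Rightarrow> _)"
  by (simp add: big_bracket_eq is_big_bracket_bracket_formula)

definition multivectors :: "nat \<Rightarrow> 'a::real_normed_vector dbl set" where
  "multivectors k = span {prod_list (map of_vec vs) |vs. length vs = k}"

lemma multivectors_eq_bidegree: "multivectors k = bidegree (int k - 1) (-1)"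
  unfolding multivectors_def bidegree_def by (rule arg_cong[of _ _ span]) auto

lemma subspace_multivectors: "subspace (multivectors k)" unfolding multivectors_def by simp

text \<open>
  The element of $V^* \otimes \bigwedge V$ corresponding to a linear map on $V$; see
  \<open>cochain_rank_one\<close> below.
\<close>

definition cochain :: "('a::euclidean_space \<Rightarrow> 'a dbl) \<Rightarrow> 'a dbl" where
  "cochain F = (\<Sum>b\<in>Basis. of_covec (blinfun_inner_left b) * F b)"

lemma blinfun_representation: "(\<Sum>b\<in>Basis. blinfun_apply \<alpha> b *\<^sub>R blinfun_inner_left b) = \<alpha>"
  for \<alpha> :: "'a::euclidean_space dual"
proof (rule blinfun_eqI)
  fix y
  have "(\<Sum>b\<in>Basis. blinfun_apply \<alpha> b * (y \<bullet> b)) = blinfun_apply \<alpha> (\<Sum>b\<in>Basis. (y \<bullet> b) *\<^sub>R b)"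
    by (simp add: blinfun.sum_right blinfun.scaleR_right mult.commute)
  then show "blinfun_apply (\<Sum>b\<in>Basis. blinfun_apply \<alpha> b *\<^sub>R blinfun_inner_left b) y = blinfun_apply \<alpha> y"
    by (simp add: blinfun.sum_left blinfun.scaleR_left euclidean_representation)
qed

lemma cochain_rank_one: "cochain (\<lambda>x. blinfun_apply \<alpha> x *\<^sub>R P) = of_covec \<alpha> * P"
proof -
  have "cochain (\<lambda>x. blinfun_apply \<alpha> x *\<^sub>R P) = of_covec (\<Sum>b\<in>Basis. blinfun_apply \<alpha> b *\<^sub>R blinfun_inner_left b) * P"
    by (simp add: cochain_def linear_sum[OF linear_of_covec] linear_scale[OF linear_of_covec] sum_distrib_right)
  then show ?thesis by (simp add: blinfun_representation)
qed

text \<open>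
  The derivation of $\bigwedge(V^* \oplus V)$ extending $[x, \cdot]$ on $V$ and vanishing on $V^*$, see
  \<open>ad_of_vec\<close>, \<open>ad_of_covec\<close>, \<open>ad_times\<close>.  It is only used on $\bigwedge V$, where the
  convention on $V^*$ is irrelevant.
\<close>

definition ad :: "('a::euclidean_space \<Rightarrow> 'a \<Rightarrow> 'a) \<Rightarrow> 'a \<Rightarrow> 'a dbl \<Rightarrow> 'a dbl" where
  "ad br x \<Theta> = (\<Sum>b\<in>Basis. of_vec (br x b) * contract (0, blinfun_inner_left b) \<Theta>)"

lemma linear_ad: "linear (ad br x)"
  by (rule linearI) (simp_all add: ad_def distrib_left sum.distrib scaleR_sum_right)

lemma linear_rep:
  fixes f :: "'a::euclidean_space \<Rightarrow> 'b::real_vector"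
  assumes "linear f" shows "(\<Sum>b\<in>Basis. (x \<bullet> b) *\<^sub>R f b) = f x"
proof -
  have "(\<Sum>b\<in>Basis. (x \<bullet> b) *\<^sub>R f b) = f (\<Sum>b\<in>Basis. (x \<bullet> b) *\<^sub>R b)"
    by (simp add: linear_sum[OF assms] linear_scale[OF assms])
  then show ?thesis by (simp add: euclidean_representation)
qed

lemma ad_of_vec: "linear (br x) \<Longrightarrow> ad br x (of_vec v) = of_vec (br x v)"
  using linear_rep[OF linear_compose[OF _ linear_of_vec], of "br x" v] by (simp add: ad_def o_def)

lemma ad_of_covec: "ad br x (of_covec \<alpha>) = 0"
  by (simp add: ad_def)

lemma of_vec_parity: "of_vec v * parity \<sigma> = \<sigma> * of_vec v"
proof (rule altform_eqI)
  fix ws show "apply_form (of_vec v * parity \<sigma>) ws = apply_form (\<sigma> * of_vec v) ws"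
  proof (induction ws arbitrary: \<sigma>)
    case (Cons w ws)
    have *: "apply_form \<tau> (w # ws) = apply_form (contract w \<tau>) ws" for \<tau> by simp
    show ?case unfolding * contract_times
      by (cases w) (simp add: contract_parity Cons)
  qed simp
qed

lemma ad_times: "ad br x (\<sigma> * \<tau>) = ad br x \<sigma> * \<tau> + \<sigma> * ad br x \<tau>"
proof -
  have "of_vec v * contract w (\<sigma> * \<tau>) = of_vec v * contract w \<sigma> * \<tau> + \<sigma> * (of_vec v * contract w \<tau>)" for v w
    unfolding contract_times distrib_left mult.assoc[symmetric] of_vec_parity ..
  then show ?thesis by (simp add: ad_def sum.distrib sum_distrib_left sum_distrib_right)
qed

lemma ad_one: "ad br x 1 = 0" by (simp add: ad_def)

lemma ad_multivectors: "\<Theta> \<in> multivectors k \<Longrightarrow> ad br x \<Theta> \<in> multivectors k"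
  unfolding ad_def multivectors_eq_bidegree
proof (rule subspace_sum[OF subspace_bidegree])
  fix b :: 'a assume "\<Theta> \<in> bidegree (int k - 1) (-1)"
  from times_bidegree[OF of_vec_bidegree contract_bidegree(2)[OF this], of "br x b"]
  show "of_vec (br x b) * contract (0, blinfun_inner_left b) \<Theta> \<in> bidegree (int k - 1) (-1)" by simp
qed

definition lie_bracket :: "('b::real_vector \<Rightarrow> 'b \<Rightarrow> 'b) \<Rightarrow> bool" where
  "lie_bracket br \<longleftrightarrow> bilinear br \<and> (\<forall>x. br x x = 0) \<and>
     (\<forall>x y z. br x (br y z) + br y (br z x) + br z (br x y) = 0)"

text \<open>
  The element $\mu$ encoding the Lie bracket; the sign is the one required by
  \<open>coboundary_multivectors\<close>, that is, by $(\delta\Theta)(x) = [x, \Theta]$.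
\<close>

definition structure_element :: "('a::euclidean_space \<Rightarrow> 'a \<Rightarrow> 'a) \<Rightarrow> 'a dbl" where
  "structure_element br = - (1/2) *\<^sub>R (\<Sum>a\<in>Basis. \<Sum>b\<in>Basis.
     of_covec (blinfun_inner_left a) * of_covec (blinfun_inner_left b) * of_vec (br a b))"

lemma structure_element_bidegree: "structure_element br \<in> bidegree 0 1"
  unfolding structure_element_def
proof (intro subspace_scale[OF subspace_bidegree] subspace_sum[OF subspace_bidegree])
  fix a b :: 'a
  from bidegree_prodI[of "[blinfun_inner_left a, blinfun_inner_left b]" 1 "[br a b]" 0]
  show "of_covec (blinfun_inner_left a) * of_covec (blinfun_inner_left b) * of_vec (br a b) \<in> bidegree 0 1"
    by (simp add: mult.assoc)
qed

definition coboundary :: "('a::euclidean_space \<Rightarrow> 'a \<Rightarrow> 'a) \<Rightarrow> 'a dbl \<Rightarrow> 'a dbl" where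
  "coboundary br = big_bracket (structure_element br)"

lemma bracket_formula_of_vec: "bracket_formula \<sigma> (of_vec v) = parity (contract (v, 0) \<sigma>)"
proof -
  have "linear (\<lambda>b::'a. (b, 0::'a dual))" by (rule linearI) auto
  from linear_compose[OF linear_compose[OF this linear_contract_left] linear_parity]
  have lin: "linear (\<lambda>b. parity (contract (b, 0) \<sigma>))" by (simp add: o_def)
  have "bracket_formula \<sigma> (of_vec v) = (\<Sum>b\<in>Basis. (v \<bullet> b) *\<^sub>R parity (contract (b, 0) \<sigma>))"
    by (simp add: bracket_formula_def sum_dbl_index dbl_basis_def opp_def)
  also have "\<dots> = parity (contract (v, 0) \<sigma>)"
    by (rule linear_rep[OF lin])
  finally show ?thesis .
qed

lemma coboundary_of_vec:
  assumes "lie_bracket br"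
  shows "bracket_formula (structure_element br) (of_vec v) = cochain (\<lambda>x. ad br x (of_vec v))"
proof -
  let ?c = "\<lambda>b. of_covec (blinfun_inner_left b)"
  have bil: "bilinear br" and alt: "\<And>x. br x x = 0" using assms by (auto simp: lie_bracket_def)
  have lin1: "linear (\<lambda>x. br x y)" and lin2: "linear (br x)" for x y using bil by (auto simp: bilinear_def)
  have anti: "br x y = - br y x" for x y
    using alt[of "x + y"] alt[of x] alt[of y] bil
    by (simp add: bilinear_ladd bilinear_radd add_eq_0_iff2)
  have lv: "linear (\<lambda>x. of_vec (br x y))" "linear (\<lambda>y. of_vec (br x y))" for x y
    using linear_compose[OF lin1 linear_of_vec] linear_compose[OF lin2 linear_of_vec] by (auto simp: o_def)
  have "bracket_formula (structure_element br) (of_vec v) = - (1/2) *\<^sub>R (\<Sum>a\<in>Basis. \<Sum>b\<in>Basis.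
     (v \<bullet> a) *\<^sub>R (?c b * of_vec (br a b)) - (v \<bullet> b) *\<^sub>R (?c a * of_vec (br a b)))"
    unfolding bracket_formula_of_vec structure_element_def
    by (simp add: contract_sum parity_sum contract_times parity_times left_diff_distrib)
  also have "(\<Sum>a\<in>Basis. \<Sum>b\<in>Basis. (v \<bullet> a) *\<^sub>R (?c b * of_vec (br a b)) - (v \<bullet> b) *\<^sub>R (?c a * of_vec (br a b))) =
     (\<Sum>b\<in>Basis. ?c b * (\<Sum>a\<in>Basis. (v \<bullet> a) *\<^sub>R of_vec (br a b))) - (\<Sum>a\<in>Basis. ?c a * (\<Sum>b\<in>Basis. (v \<bullet> b) *\<^sub>R of_vec (br a b)))"
    unfolding sum_subtractf sum_distrib_left mult_scaleR_right
    by (subst sum.swap) simp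
  also have "\<dots> = (\<Sum>b\<in>Basis. ?c b * of_vec (br v b)) - (\<Sum>a\<in>Basis. ?c a * of_vec (br a v))"
    using linear_rep[OF lv(1)] linear_rep[OF lv(2)] by simp
  also have "(\<Sum>b\<in>Basis. ?c b * of_vec (br v b)) = - (\<Sum>a\<in>Basis. ?c a * of_vec (br a v))"
    by (subst anti) (simp add: linear_neg[OF linear_of_vec] sum_negf)
  also have "- (1/2) *\<^sub>R (- \<sigma> - \<sigma>) = \<sigma>" for \<sigma> :: "'a dbl" by (rule altform_eqI) simp
  finally show ?thesis by (simp add: cochain_def ad_of_vec lin2)
qed

theorem coboundary_multivectors:
  assumes "lie_bracket br" "\<Theta> \<in> multivectors k"
  shows "coboundary br \<Theta> = cochain (\<lambda>x. ad br x \<Theta>)"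
proof -
  let ?m = "structure_element br"
  have h1: "homogeneous 1 ?m" using homogeneous_bidegree[OF structure_element_bidegree] by simp
  have P: "bracket_formula ?m (prod_list (map of_vec vs)) = cochain (\<lambda>x. ad br x (prod_list (map of_vec vs)))" for vs
  proof (induction vs)
    case Nil show ?case by (simp add: cochain_def ad_one)
  next
    case (Cons v vs)
    have *: "of_vec v * of_covec \<alpha> = - (of_covec \<alpha> * of_vec v)" for \<alpha>
      using of_vec_parity[of v "of_covec \<alpha>"] by (simp add: minus_equation_iff eq_commute)
    have "of_vec v * (of_covec \<alpha> * \<sigma>) = - (of_covec \<alpha> * (of_vec v * \<sigma>))" for \<alpha> \<sigma>
      by (simp add: * flip: mult.assoc)
    then have "of_vec v * cochain F = - cochain (\<lambda>x. of_vec v * F x)" for F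
      by (simp add: cochain_def sum_distrib_left sum_negf)
    moreover have "cochain (\<lambda>x. ad br x (of_vec v)) * \<tau> = cochain (\<lambda>x. ad br x (of_vec v) * \<tau>)" for \<tau>
      by (simp add: cochain_def sum_distrib_right mult.assoc)
    ultimately show ?case
      using bracket_formula_deriv[OF h1 homogeneous_of_vec, of v "prod_list (map of_vec vs)"]
      by (simp add: Cons coboundary_of_vec[OF assms(1)] powi_neg1 ad_times)
         (simp add: cochain_def distrib_left sum.distrib)
  qed
  have "linear (bracket_formula ?m)" using bilinear_bracket_formula by (auto simp: bilinear_def)
  moreover have "linear (\<lambda>\<Theta>. cochain (\<lambda>x. ad br x \<Theta>))"
    by (rule linearI) (simp_all add: cochain_def linear_add[OF linear_ad] linear_scale[OF linear_ad] distrib_left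
      sum.distrib scaleR_sum_right)
  ultimately have "bracket_formula ?m \<Theta> = cochain (\<lambda>x. ad br x \<Theta>)"
    by (rule linear_eq_on[OF _ _ assms(2)[unfolded multivectors_def]]) (use P in auto)
  then show ?thesis by (simp add: coboundary_def big_bracket_eq)
qed

definition schouten_square :: "('a::euclidean_space \<Rightarrow> 'a \<Rightarrow> 'a) \<Rightarrow> 'a dbl \<Rightarrow> 'a dbl" where
  "schouten_square br r = big_bracket r (big_bracket (structure_element br) r)"

definition invariants :: "('a::euclidean_space \<Rightarrow> 'a \<Rightarrow> 'a) \<Rightarrow> nat \<Rightarrow> 'a dbl set" where
  "invariants br k = {\<Theta> \<in> multivectors k. \<forall>x. ad br x \<Theta> = 0}"

definition cocycles :: "('a::euclidean_space \<Rightarrow> 'a \<Rightarrow> 'a) \<Rightarrow> ('a \<Rightarrow> 'a dbl) set" where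
  "cocycles br = {\<xi>. linear \<xi> \<and> (\<forall>x. \<xi> x \<in> multivectors 2) \<and>
     (\<forall>x y. \<xi> (br x y) = ad br x (\<xi> y) - ad br y (\<xi> x))}"

text \<open>
  $[\alpha, \beta]_*(x) = \langle \xi(x), \alpha \wedge \beta\rangle$; the pairing of a bivector with
  $\alpha \wedge \beta$ is its value as a form on $\alpha$, $\beta$, see
  \<open>apply_of_vec_times_of_vec\<close>.
\<close>

definition dual_bracket :: "('a::euclidean_space \<Rightarrow> 'a dbl) \<Rightarrow> 'a dual \<Rightarrow> 'a dual \<Rightarrow> 'a dual" where
  "dual_bracket \<xi> \<alpha> \<beta> = Blinfun (\<lambda>x. apply_form (\<xi> x) [(0, \<alpha>), (0, \<beta>)])"

lemma dual_bracket_apply: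
  assumes "linear \<xi>"
  shows "blinfun_apply (dual_bracket \<xi> \<alpha> \<beta>) x = apply_form (\<xi> x) [(0, \<alpha>), (0, \<beta>)]"
proof -
  have "linear (\<lambda>x. apply_form (\<xi> x) [(0, \<alpha>), (0, \<beta>)])"
    by (rule linearI) (simp_all add: linear_add[OF assms] linear_scale[OF assms])
  then show ?thesis
    unfolding dual_bracket_def by (simp add: bounded_linear_Blinfun_apply linear_conv_bounded_linear)
qed

definition lie_bialgebra_structure :: "('a::euclidean_space \<Rightarrow> 'a \<Rightarrow> 'a) \<Rightarrow> ('a \<Rightarrow> 'a dbl) \<Rightarrow> bool" where
  "lie_bialgebra_structure br \<xi> \<longleftrightarrow> \<xi> \<in> cocycles br \<and> lie_bracket (dual_bracket \<xi>)"

text \<open>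
  The Levi-Civita connection of the left-invariant metric, on left-invariant vector fields, by the
  Koszul formula (see \<open>koszul\<close>).  Its curvature tensor is left-invariant, so it vanishes if and only
  if it vanishes on left-invariant fields.
\<close>

definition levi_civita :: "('a::euclidean_space \<Rightarrow> 'a \<Rightarrow> 'a) \<Rightarrow> 'a \<Rightarrow> 'a \<Rightarrow> 'a" where
  "levi_civita br x y = (\<Sum>b\<in>Basis. ((br x y \<bullet> b - br y b \<bullet> x + br b x \<bullet> y) / 2) *\<^sub>R b)"

lemma koszul:
  assumes "bilinear br"
  shows "2 * (levi_civita br x y \<bullet> z) = br x y \<bullet> z - br y z \<bullet> x + br z x \<bullet> y"
proof -
  have "linear (\<lambda>z. (br x y \<bullet> z - br y z \<bullet> x + br z x \<bullet> y) / 2)"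
    by (rule linearI)
       (simp_all add: bilinear_ladd[OF assms] bilinear_radd[OF assms] bilinear_lmul[OF assms]
          bilinear_rmul[OF assms] inner_simps algebra_simps add_divide_distrib diff_divide_distrib)
  from linear_rep[OF this, of z] show ?thesis
    by (simp add: levi_civita_def inner_sum_left inner_commute[of z] mult.commute)
qed

definition flat_metric_lie_algebra :: "('a::euclidean_space \<Rightarrow> 'a \<Rightarrow> 'a) \<Rightarrow> bool" where
  "flat_metric_lie_algebra br \<longleftrightarrow> lie_bracket br \<and>
     (\<forall>x y z. levi_civita br x (levi_civita br y z) - levi_civita br y (levi_civita br x z)
       - levi_civita br (br x y) z = 0)"

definition center :: "('a::real_vector \<Rightarrow> 'a \<Rightarrow> 'a) \<Rightarrow> 'a set" where
  "center br = {z. \<forall>x. br x z = 0}"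

definition derived_algebra :: "('a::real_vector \<Rightarrow> 'a \<Rightarrow> 'a) \<Rightarrow> 'a set" where
  "derived_algebra br = span {br x y |x y. True}"

text \<open>
  Determinant $1$ is automatic for an orthogonal map with square $-1$ on a plane.
\<close>

definition orthogonal_complex_structure :: "'a::euclidean_space set \<Rightarrow> ('a \<Rightarrow> 'a) \<Rightarrow> bool" where
  "orthogonal_complex_structure P J \<longleftrightarrow>
     (\<forall>v\<in>P. J v \<in> P) \<and>
     (\<forall>v\<in>P. \<forall>w\<in>P. J (v + w) = J v + J w) \<and> (\<forall>c. \<forall>v\<in>P. J (c *\<^sub>R v) = c *\<^sub>R J v) \<and>
     (\<forall>v\<in>P. \<forall>w\<in>P. J v \<bullet> J w = v \<bullet> w) \<and>
     (\<forall>v\<in>P. J (J v) = - v)"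

text \<open>
  The functional \<open>lam l\<close> and the map \<open>J l\<close> matter only on \<open>\<s>\<close> and on \<open>P l\<close>.
\<close>

definition milnor_decomposition ::
  "('a::euclidean_space \<Rightarrow> 'a \<Rightarrow> 'a) \<Rightarrow> 'a set \<Rightarrow> nat \<Rightarrow> (nat \<Rightarrow> 'a set) \<Rightarrow> (nat \<Rightarrow> 'a \<Rightarrow> real) \<Rightarrow> (nat \<Rightarrow> 'a \<Rightarrow> 'a) \<Rightarrow> bool"
  where
  "milnor_decomposition br \<s> m P lam J \<longleftrightarrow>
     (let \<z> = center br; \<u> = derived_algebra br in
     subspace \<s> \<and> (\<forall>s\<in>\<s>. \<forall>t\<in>\<s>. br s t = 0) \<and>
     (\<forall>s\<in>\<s>. \<forall>z\<in>\<z>. orthogonal s z) \<and> (\<forall>s\<in>\<s>. \<forall>u\<in>\<u>. orthogonal s u) \<and> (\<forall>z\<in>\<z>. \<forall>u\<in>\<u>. orthogonal z u) \<and>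
     (\<forall>x. \<exists>s\<in>\<s>. \<exists>z\<in>\<z>. \<exists>u\<in>\<u>. x = s + z + u) \<and>
     even (dim \<u>) \<and> (\<forall>u\<in>\<u>. \<forall>v\<in>\<u>. br u v = 0) \<and> (\<forall>x. \<forall>u\<in>\<u>. br x u \<in> \<u>) \<and>
     (\<forall>s\<in>\<s>. \<forall>u\<in>\<u>. \<forall>v\<in>\<u>. br s u \<bullet> v = - (u \<bullet> br s v)) \<and>
     (\<forall>s\<in>\<s>. \<forall>t\<in>\<s>. \<forall>u\<in>\<u>. br s (br t u) = br t (br s u)) \<and>
     (\<forall>l\<in>{1..m}. subspace (P l) \<and> dim (P l) = 2 \<and> (\<forall>s\<in>\<s>. \<forall>v\<in>P l. br s v \<in> P l)) \<and>
     (\<forall>i\<in>{1..m}. \<forall>j\<in>{1..m}. i \<noteq> j \<longrightarrow> (\<forall>v\<in>P i. \<forall>w\<in>P j. orthogonal v w)) \<and>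
     \<u> = span (\<Union>l\<in>{1..m}. P l) \<and>
     (\<forall>l\<in>{1..m}.
        (\<forall>s\<in>\<s>. \<forall>t\<in>\<s>. lam l (s + t) = lam l s + lam l t) \<and> (\<forall>c. \<forall>s\<in>\<s>. lam l (c *\<^sub>R s) = c * lam l s) \<and>
        (\<exists>s\<in>\<s>. lam l s \<noteq> 0) \<and>
        orthogonal_complex_structure (P l) (J l) \<and>
        (\<forall>s\<in>\<s>. \<forall>v\<in>P l. br s v = lam l s *\<^sub>R J l v)))"

end

theory Submission
  imports Defs
begin

text \<open>
  Since $\delta r = \mathrm{ad}\,r$ and $\delta R = 0$, the graded Jacobi identity gives
  $\{\xi, \xi\} = \delta\Psi + \{R, R\}$ (\<open>twisted_cocycle_square\<close>).  Hence (ii) implies (i), and (ii)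
  and (iii) are equivalent because $\delta\Psi$ is the map $x \mapsto \mathrm{ad}_x\Psi$
  (\<open>coboundary_eq_0_iff\<close>).  That $\{\xi, \xi\} = 0$ is the Jacobi identity of the dual bracket holds
  for every linear map into bivectors (\<open>lie_bracket_dual_bracket_iff\<close>).

  The content is that $\delta\Psi + \{R, R\} = 0$ forces both terms to vanish
  (\<open>cocycle_square_zero\<close>).  Evaluated at $x$ the equation reads $\mathrm{ad}_x\Psi = 2\{R, R(x)\}$.
  For $x = a \in \mathfrak a$ the right-hand side is invariant (\<open>bracket_cocycle_invariant\<close>), so
  $\mathrm{ad}_a^2\Psi = 0$; as $\mathrm{ad}_a$ is skew-symmetric, $\mathrm{ad}_a\Psi = 0$
  (\<open>ad_skew_semisimple\<close>).  For $x = u \in P_\ell$ it equals $2\omega \wedge u$ with $\omega = R(A_\ell)$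
  invariant, while the left-hand side is divisible by $J_\ell u$, because every bracket $[u, y]$ is a
  multiple of $J_\ell u$.  Thus $\omega \wedge u \wedge J_\ell u = 0$.  The assumption on the weights
  makes $P_\ell$ a full isotypic component of $\mathfrak g$ under $\mathfrak s$
  (\<open>isotypic_in_P\<close>), so contracting $\omega$ with a covector of $P_\ell$ gives a vector of $P_\ell$.
  Contracting $\omega \wedge u \wedge J_\ell u = 0$ with $J_\ell u$ then leaves a nonzero multiple of
  $\omega \wedge u$ (\<open>ad_image_meets_invariant_multiples\<close>).
\<close>

section \<open>Bidegree and contraction\<close>

text \<open>
  Substituting the bracket $[x, y] := y$ turns \<open>ad\<close> into the derivation counting the vector factors
  of a product.  Where vector factors are present its eigenvalue is nonzero, so an element whose
  contractions with covectors all vanish, being killed by it, is zero; this is how equations in the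
  exterior algebra are reduced below to equations between contractions.
\<close>

lemma ad_id_bidegree:
  fixes \<sigma> :: "'a::euclidean_space dbl"
  assumes "\<sigma> \<in> bidegree p q"
  shows "ad (\<lambda>_ y. y) x \<sigma> = real_of_int (p + 1) *\<^sub>R \<sigma>"
proof -
  let ?N = "ad (\<lambda>_ y. y) x"
  have cov: "?N (prod_list (map of_covec \<alpha>s)) = 0" for \<alpha>s :: "'a dual list"
    by (induction \<alpha>s) (simp_all add: ad_one ad_times ad_of_covec)
  have vec: "?N (prod_list (map of_vec vs)) = real (length vs) *\<^sub>R prod_list (map of_vec vs)" for vs :: "'a list"
    by (induction vs) (simp_all add: ad_one ad_times ad_of_vec linear_id[unfolded id_def] algebra_simps)
  show ?thesis
    using assms
  proof (induction rule: bidegree_induct)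
    case (prod \<alpha>s vs)
    then have "real (length vs) = real_of_int (p + 1)" by (metis of_int_of_nat_eq)
    then show ?case by (simp only: ad_times cov vec) simp
  qed (simp_all add: linear_0[OF linear_ad] linear_add[OF linear_ad] linear_scale[OF linear_ad] scaleR_add_right)
qed

lemma bidegree_eq_0_if_contract_covecs:
  fixes \<sigma> :: "'a::euclidean_space dbl"
  assumes "\<sigma> \<in> bidegree p q" "0 \<le> p" "\<And>b. b \<in> Basis \<Longrightarrow> contract (0, blinfun_inner_left b) \<sigma> = 0"
  shows "\<sigma> = 0"
proof -
  have "ad (\<lambda>_ y. y) 0 \<sigma> = 0"
    by (simp add: ad_def assms(3))
  then show ?thesis
    using ad_id_bidegree[OF assms(1), of 0] assms(2) by simp
qed

lemma bidegree_eq_0_if_contract_vecs: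
  fixes \<sigma> :: "'a::euclidean_space dbl"
  assumes "\<sigma> \<in> bidegree p q" "0 \<le> q" "\<And>x. contract (x, 0) \<sigma> = 0"
  shows "\<sigma> = 0"
proof -
  \<comment> \<open>The operator counting all factors reduces to the one counting vectors once the contractions with
    vectors vanish, but its eigenvalue is larger by $q + 1$, the number of covectors.\<close>
  have "euler \<sigma> = ad (\<lambda>_ y. y) 0 \<sigma>"
    by (simp add: euler_def ad_def sum_dbl_index gform_def dbl_basis_def assms(3))
  also have "\<dots> = real_of_int (p + 1) *\<^sub>R \<sigma>"
    by (rule ad_id_bidegree[OF assms(1)])
  finally have e: "euler \<sigma> = real_of_int (p + 1) *\<^sub>R \<sigma>" .
  have "apply_form \<sigma> ws = 0" for ws
  proof (cases "int (length ws) = p + q + 2")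
    case True
    then have "real (length ws) = real_of_int (p + q + 2)" by (metis of_int_of_nat_eq)
    moreover have "real (length ws) * apply_form \<sigma> ws = real_of_int (p + 1) * apply_form \<sigma> ws"
      using arg_cong[OF e, of "\<lambda>x. apply_form x ws"] by (simp add: apply_euler)
    ultimately show ?thesis using assms(2) by auto
  qed (use homogeneous_bidegree[OF assms(1)] in \<open>auto simp: homogeneous_def\<close>)
  then show ?thesis by (intro altform_eqI) simp
qed

section \<open>Multivectors and cochains\<close>

lemma homogeneous_multivector: "\<Theta> \<in> multivectors k \<Longrightarrow> homogeneous (int k - 2) \<Theta>"
  using homogeneous_bidegree[of \<Theta> "int k - 1" "-1"] by (simp add: multivectors_eq_bidegree)

lemma contract_vec_multivector:
  assumes "\<Theta> \<in> multivectors k"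
  shows "contract (x, 0) \<Theta> = 0"
  using assms unfolding multivectors_def
  by (induction rule: span_induct_alt) (auto simp: contract_prod_of_vec)

lemma contract_covec_multivector:
  assumes "\<Theta> \<in> multivectors (Suc k)"
  shows "contract (0, \<phi>) \<Theta> \<in> multivectors k"
  using contract_bidegree(2)[of \<Theta> "int k" "-1" \<phi>] assms by (simp add: multivectors_eq_bidegree)

lemma multivectors_0_E:
  assumes "\<Theta> \<in> multivectors 0"
  shows "\<Theta> = apply_form \<Theta> [] *\<^sub>R 1"
  using homogeneous_multivector[OF assms]
  by (intro altform_eqI) (auto simp: homogeneous_def)

lemma multivectors_1_E:
  assumes "\<Theta> \<in> multivectors 1"
  obtains v where "\<Theta> = of_vec v"
proof -
  have "\<exists>v. \<Theta> = of_vec v"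
    using assms unfolding multivectors_def
  proof (induction rule: span_induct_alt)
    case base
    show ?case using linear_0[OF linear_of_vec] by metis
  next
    case (step c x y)
    then obtain vs v where "x = prod_list (map of_vec vs)" "length vs = 1" "y = of_vec v" by auto
    then obtain w where "x = of_vec w" by (auto simp: length_Suc_conv)
    then have "c *\<^sub>R x + y = of_vec (c *\<^sub>R w + v)"
      using \<open>y = of_vec v\<close> by (simp add: linear_add[OF linear_of_vec] linear_scale[OF linear_of_vec])
    then show ?case by blast
  qed
  then show thesis using that by blast
qed

lemma contract_cochain:
  assumes "linear F" "\<And>x. F x \<in> multivectors k"
  shows "contract (x, 0) (cochain F) = F x"
proof -
  have "contract (x, 0) (cochain F) = (\<Sum>b\<in>Basis. (x \<bullet> b) *\<^sub>R F b)"
    using contract_vec_multivector[OF assms(2)]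
    by (simp add: cochain_def contract_sum contract_times)
  then show ?thesis by (simp add: linear_rep[OF assms(1)])
qed

lemma cochain_bidegree:
  assumes "\<And>x. F x \<in> multivectors k"
  shows "cochain F \<in> bidegree (int k - 1) 0"
  unfolding cochain_def
proof (rule subspace_sum[OF subspace_bidegree])
  fix b :: 'a
  show "of_covec (blinfun_inner_left b) * F b \<in> bidegree (int k - 1) 0"
    using times_bidegree[OF of_covec_bidegree assms[of b, unfolded multivectors_eq_bidegree]] by simp
qed

lemma cochain_eq_0_iff:
  assumes "linear F" "\<And>x. F x \<in> multivectors k"
  shows "cochain F = 0 \<longleftrightarrow> (\<forall>x. F x = 0)"
  using contract_cochain[OF assms] by (auto simp: cochain_def)

section \<open>Cocycles and the coboundary\<close>

lemma linear_ad_left: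
  assumes "bilinear br"
  shows "linear (\<lambda>x. ad br x \<Theta>)"
  by (rule linearI)
     (simp_all add: ad_def bilinear_ladd[OF assms] bilinear_lmul[OF assms] linear_add[OF linear_of_vec]
       linear_scale[OF linear_of_vec] distrib_right sum.distrib scaleR_sum_right)

lemma lie_bracket_skew:
  assumes "lie_bracket br"
  shows "br x y = - br y x"
proof -
  have bil: "bilinear br" and alt: "\<And>x. br x x = 0" using assms by (auto simp: lie_bracket_def)
  show ?thesis
    using alt[of "x + y"] alt[of x] alt[of y] bil
    by (simp add: bilinear_ladd bilinear_radd add_eq_0_iff2)
qed

text \<open>
  Both sides are derivations, so the identity spreads from single vectors, where it is the Jacobi
  identity, to all multivectors.
\<close>

lemma ad_bracket:
  assumes br: "lie_bracket br" and \<Theta>: "\<Theta> \<in> multivectors k"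
  shows "ad br (br x y) \<Theta> = ad br x (ad br y \<Theta>) - ad br y (ad br x \<Theta>)"
proof -
  have bil: "bilinear br" and jac: "\<And>x y z. br x (br y z) + br y (br z x) + br z (br x y) = 0"
    using br by (auto simp: lie_bracket_def)
  have lin: "linear (br x)" for x using bil by (simp add: bilinear_def)
  have j: "br (br x y) z = br x (br y z) - br y (br x z)" for z
    using jac[of x y z] lie_bracket_skew[OF br, of "br x y" z] lie_bracket_skew[OF br, of z x]
    by (simp add: bilinear_rneg[OF bil] algebra_simps add_eq_0_iff)
  have prod: "ad br (br x y) (prod_list (map of_vec vs)) =
      ad br x (ad br y (prod_list (map of_vec vs))) - ad br y (ad br x (prod_list (map of_vec vs)))" for vs
  proof (induction vs)
    case (Cons v vs)
    show ?case
      by (simp add: Cons ad_times ad_of_vec lin j linear_add[OF linear_ad] linear_diff[OF linear_of_vec]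
          left_diff_distrib right_diff_distrib)
  qed (simp add: ad_one linear_0[OF linear_ad])
  show ?thesis
    using \<Theta> unfolding multivectors_def
    by (induction rule: span_induct_alt)
       (auto simp: linear_0[OF linear_ad] linear_add[OF linear_ad] linear_scale[OF linear_ad] prod algebra_simps)
qed

lemma ad_cocycle:
  assumes "lie_bracket br" "r \<in> multivectors 2"
  shows "(\<lambda>x. ad br x r) \<in> cocycles br"
  using assms ad_bracket[OF assms] linear_ad_left[of br r] ad_multivectors[OF assms(2)]
  by (auto simp: cocycles_def lie_bracket_def)

text \<open>
  The next two lemmas recover from the normalization of the structure element what its contractions
  do: one contraction acts on multivectors as \<open>ad br x\<close>, two contractions give the bracket up to sign.
\<close>

lemma contract_contract_structure_element:
  assumes "lie_bracket br"
  shows "contract (y, 0) (contract (x, 0) (structure_element br)) = - of_vec (br x y)"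
proof -
  let ?m = "structure_element br"
  have bil: "bilinear br" using assms by (simp add: lie_bracket_def)
  then have lin: "linear (br x)" for x by (simp add: bilinear_def)
  have l: "linear (\<lambda>x. of_vec (br x y))" "\<And>x. of_vec (br x y) \<in> multivectors 1"
    using linear_compose[OF _ linear_of_vec, of "\<lambda>x. br x y"] bil of_vec_bidegree
    by (auto simp: bilinear_def o_def multivectors_eq_bidegree)
  have "parity (contract (y, 0) ?m) = cochain (\<lambda>x. of_vec (br x y))"
    using coboundary_of_vec[OF assms, of y] by (simp add: bracket_formula_of_vec ad_of_vec lin)
  then have "contract (x, 0) (parity (contract (y, 0) ?m)) = of_vec (br x y)"
    using contract_cochain[OF l] by simp
  then have "parity (contract (x, 0) (contract (y, 0) ?m)) = - of_vec (br x y)"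
    by (metis contract_parity minus_minus)
  from arg_cong[OF this, of parity] have "contract (x, 0) (contract (y, 0) ?m) = of_vec (br x y)"
    by simp
  then show ?thesis
    using contract_anticomm[of "(y, 0)" "(x, 0)" ?m] by simp
qed

lemma bracket_contract_structure_element:
  assumes "lie_bracket br" "\<Theta> \<in> multivectors k"
  shows "bracket_formula (contract (x, 0) (structure_element br)) \<Theta> = ad br x \<Theta>"
proof -
  have bil: "bilinear br" using assms by (simp add: lie_bracket_def)
  have "contract (x, 0) (bracket_formula (structure_element br) \<Theta>) = ad br x \<Theta>"
    using coboundary_multivectors[OF assms] contract_cochain[OF linear_ad_left[OF bil] ad_multivectors[OF assms(2)]]
    by (simp add: coboundary_def big_bracket_eq)
  then show ?thesis
    by (simp add: contract_bracket_formula contract_vec_multivector[OF assms(2)])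
qed

lemma bracket_of_vec_cochain:
  assumes "linear F" "\<And>x. F x \<in> multivectors 2"
  shows "bracket_formula (cochain F) (of_vec v) = F v" "bracket_formula (of_vec v) (cochain F) = F v"
proof -
  have h: "homogeneous 1 (cochain F)"
    using homogeneous_bidegree[OF cochain_bidegree[OF assms(2)]] by simp
  show 1: "bracket_formula (cochain F) (of_vec v) = F v"
    using parity_hom[OF homogeneous_multivector[OF assms(2)], of v]
    by (simp add: bracket_formula_of_vec contract_cochain[OF assms])
  show "bracket_formula (of_vec v) (cochain F) = F v"
    using bracket_formula_antisym[OF homogeneous_of_vec h, of v] by (simp add: 1 powi_neg1)
qed

text \<open>
  Contracting $\{\mu, F\}$ with $x$ and $y$ gives $\mathrm{ad}_x F(y) - \mathrm{ad}_y F(x) - F([x, y])$,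
  and contractions with two vectors detect everything in this bidegree.
\<close>

lemma coboundary_cocycle:
  assumes br: "lie_bracket br" and F: "F \<in> cocycles br"
  shows "bracket_formula (structure_element br) (cochain F) = 0"
proof -
  let ?m = "structure_element br"
  let ?d = "bracket_formula ?m (cochain F)"
  have F1: "linear F" "\<And>x. F x \<in> multivectors 2"
    and F2: "\<And>x y. F (br x y) = ad br x (F y) - ad br y (F x)"
    using F by (auto simp: cocycles_def)
  have h: "homogeneous 1 ?m"
    using homogeneous_bidegree[OF structure_element_bidegree] by simp
  have p: "parity ?m = - ?m" "parity (contract (x, 0) ?m) = contract (x, 0) ?m" for x
    using parity_hom[OF h] parity_hom[OF homogeneous_contract[OF h]] by (simp_all add: powi_neg1)
  have "contract (y, 0) (contract (x, 0) ?d) = 0" for x y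
    using bracket_contract_structure_element[OF br F1(2)]
    by (simp add: contract_bracket_formula p contract_cochain[OF F1] contract_vec_multivector[OF F1(2)]
        contract_contract_structure_element[OF br] bracket_of_vec_cochain[OF F1] F2)
  moreover have d: "?d \<in> bidegree 1 1"
    using bracket_formula_bidegree[OF structure_element_bidegree cochain_bidegree[OF F1(2)]] by simp
  then have "contract (x, 0) ?d \<in> bidegree 1 0" for x
    using contract_bidegree(1)[of ?d 1 1 x] by simp
  ultimately have "contract (x, 0) ?d = 0" for x
    using bidegree_eq_0_if_contract_vecs[of "contract (x, 0) ?d" 1 0] by simp
  then show ?thesis
    using bidegree_eq_0_if_contract_vecs[OF d] by simp
qed

section \<open>The dual bracket and the co-Jacobi condition\<close>

definition jacobiator :: "('b::real_vector \<Rightarrow> 'b \<Rightarrow> 'b) \<Rightarrow> 'b \<Rightarrow> 'b \<Rightarrow> 'b \<Rightarrow> 'b" where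
  "jacobiator br x y z = br x (br y z) + br y (br z x) + br z (br x y)"

lemma bracket_formula_of_covec: "bracket_formula \<sigma> (of_covec \<alpha>) = parity (contract (0, \<alpha>) \<sigma>)"
proof -
  have "linear (\<lambda>\<phi>::'a dual. (0::'a, \<phi>))" by (rule linearI) auto
  from linear_compose[OF linear_compose[OF this linear_contract_left] linear_parity]
  have lin: "linear (\<lambda>\<phi>. parity (contract (0, \<phi>) \<sigma>))" by (simp add: o_def)
  have "bracket_formula \<sigma> (of_covec \<alpha>) =
      (\<Sum>b\<in>Basis. blinfun_apply \<alpha> b *\<^sub>R parity (contract (0, blinfun_inner_left b) \<sigma>))"
    by (simp add: bracket_formula_def sum_dbl_index dbl_basis_def opp_def)
  also have "\<dots> = parity (contract (0, \<Sum>b\<in>Basis. blinfun_apply \<alpha> b *\<^sub>R blinfun_inner_left b) \<sigma>)"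
    by (simp add: linear_sum[OF lin] linear_scale[OF lin])
  also have "\<dots> = parity (contract (0, \<alpha>) \<sigma>)"
    by (simp only: blinfun_representation)
  finally show ?thesis .
qed

lemma of_covec_eq_0_iff: "of_covec \<alpha> = 0 \<longleftrightarrow> \<alpha> = 0"
proof
  assume *: "of_covec \<alpha> = 0"
  show "\<alpha> = 0"
  proof (rule blinfun_eqI)
    fix x
    show "blinfun_apply \<alpha> x = blinfun_apply 0 x"
      using arg_cong[OF *, of "\<lambda>\<sigma>. apply_form \<sigma> [(x, 0)]"] by (simp add: apply_of_covec)
  qed
qed (simp add: linear_0[OF linear_of_covec])

lemma bilinear_dual_bracket:
  assumes "linear F"
  shows "bilinear (dual_bracket F)"
proof -
  have lin: "linear (\<lambda>w. apply_form \<sigma> [w, w'])" "linear (\<lambda>w. apply_form \<sigma> [w', w])" for \<sigma> :: "'a dbl" and w'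
    using linear_apply_form[of \<sigma> "[]" "[w']"] linear_apply_form[of \<sigma> "[w']" "[]"] by simp_all
  have lin0: "linear (\<lambda>\<phi>::'a dual. (0::'a, \<phi>))" by (rule linearI) auto
  note l = lin(1)[THEN linear_compose[OF lin0], unfolded o_def] lin(2)[THEN linear_compose[OF lin0], unfolded o_def]
  show ?thesis
    unfolding bilinear_def
    by (auto intro!: linearI blinfun_eqI
        simp: dual_bracket_apply[OF assms] blinfun.add_left blinfun.scaleR_left
          l[THEN linear_add] l[THEN linear_scale])
qed

lemma dual_bracket_self: "linear F \<Longrightarrow> dual_bracket F \<alpha> \<alpha> = 0"
  using apply_form_adjacent[of _ "[]" "(0, \<alpha>)" "[]"]
  by (intro blinfun_eqI) (simp add: dual_bracket_apply)

lemma dual_bracket_skew: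
  assumes "linear F" shows "dual_bracket F \<alpha> \<beta> = - dual_bracket F \<beta> \<alpha>"
  using apply_swap[of _ "(0, \<alpha>)" "(0, \<beta>)" "[]"]
  by (intro blinfun_eqI) (simp add: dual_bracket_apply[OF assms] blinfun.minus_left)

lemma contract_contract_cochain:
  assumes F: "linear F" "\<And>x. F x \<in> multivectors 2"
  shows "contract (0, \<psi>) (contract (0, \<phi>) (cochain F)) = of_covec (dual_bracket F \<phi> \<psi>)"
proof -
  have "contract (0, \<psi>) (contract (0, \<phi>) (F x)) = blinfun_apply (dual_bracket F \<phi> \<psi>) x *\<^sub>R 1" for x
  proof -
    have "contract (0, \<psi>) (contract (0, \<phi>) (F x)) \<in> multivectors 0"
      using F(2)[of x] by (simp add: contract_covec_multivector numeral_2_eq_2)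
    from multivectors_0_E[OF this] show ?thesis
      by (simp add: dual_bracket_apply[OF F(1)])
  qed
  then have "contract (0, \<psi>) (contract (0, \<phi>) (cochain F)) = cochain (\<lambda>x. blinfun_apply (dual_bracket F \<phi> \<psi>) x *\<^sub>R 1)"
    by (simp add: cochain_def contract_sum contract_times)
  then show ?thesis by (simp add: cochain_rank_one)
qed

text \<open>
  Contraction is an odd derivation of the big bracket.  Contracting $\{F, F\}$ three times therefore
  distributes the covectors over the two copies of $F$, and each distribution that survives is an
  iterated dual bracket; the three of them form the cyclic sum.
\<close>

lemma contract_bracket_cochain_self:
  assumes F: "linear F" "\<And>x. F x \<in> multivectors 2"
  shows "contract (0, \<eta>) (contract (0, \<psi>) (contract (0, \<phi>) (bracket_formula (cochain F) (cochain F)))) =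
    (-2) *\<^sub>R of_covec (jacobiator (dual_bracket F) \<phi> \<psi> \<eta>)"
proof -
  let ?X = "cochain F" and ?D = "dual_bracket F"
  have h: "homogeneous 1 ?X"
    using homogeneous_bidegree[OF cochain_bidegree[OF F(2)]] by simp
  have h': "homogeneous 0 (contract w ?X)" for w
    using homogeneous_contract[OF h, of w] by simp
  note cc = contract_contract_cochain[OF F]
  have pX: "parity ?X = - ?X" "parity (contract w ?X) = contract w ?X" for w
    using parity_hom[OF h] parity_hom[OF h'] by (simp_all add: powi_neg1)
  have comm: "bracket_formula (contract w ?X) ?X = - bracket_formula ?X (contract w ?X)" for w
    using bracket_formula_antisym[OF h' h, of w] by simp
  \<comment> \<open>Bracketing with a covector contracts, so a once contracted $F$ acts by the dual bracket.\<close>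
  have r: "bracket_formula (contract (0, \<phi>) ?X) (of_covec \<alpha>) = - of_covec (?D \<phi> \<alpha>)" for \<phi> \<alpha>
    by (simp add: bracket_formula_of_covec cc)
  have l: "bracket_formula (of_covec \<alpha>) (contract (0, \<phi>) ?X) = of_covec (?D \<phi> \<alpha>)" for \<phi> \<alpha>
    using bracket_formula_antisym[OF homogeneous_of_covec h', of \<alpha> "(0, \<phi>)"] by (simp add: r)
  have "contract (0, \<phi>) (bracket_formula ?X ?X) = (-2) *\<^sub>R bracket_formula ?X (contract (0, \<phi>) ?X)"
    by (simp add: contract_bracket_formula pX comm scaleR_2)
  moreover have "contract (0, \<eta>) (contract (0, \<psi>) (bracket_formula ?X (contract (0, \<phi>) ?X))) =
      of_covec (jacobiator ?D \<phi> \<psi> \<eta>)"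
    using dual_bracket_skew[OF F(1), of \<phi> \<eta>]
    by (simp add: contract_bracket_formula pX cc l r jacobiator_def linear_add[OF linear_of_covec]
        linear_neg[OF linear_of_covec] bilinear_rneg[OF bilinear_dual_bracket[OF F(1)]])
  ultimately show ?thesis by simp
qed

lemma lie_bracket_dual_bracket_iff:
  assumes F: "linear F" "\<And>x. F x \<in> multivectors 2"
  shows "lie_bracket (dual_bracket F) \<longleftrightarrow> bracket_formula (cochain F) (cochain F) = 0"
proof
  assume "bracket_formula (cochain F) (cochain F) = 0"
  then have "jacobiator (dual_bracket F) \<phi> \<psi> \<eta> = 0" for \<phi> \<psi> \<eta>
    using contract_bracket_cochain_self[OF F, of \<eta> \<psi> \<phi>] by (simp add: of_covec_eq_0_iff)
  then show "lie_bracket (dual_bracket F)"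
    by (simp add: lie_bracket_def bilinear_dual_bracket[OF F(1)] dual_bracket_self[OF F(1)] jacobiator_def)
next
  let ?B = "bracket_formula (cochain F) (cochain F)"
  assume "lie_bracket (dual_bracket F)"
  then have z: "contract (0, \<eta>) (contract (0, \<psi>) (contract (0, \<phi>) ?B)) = 0" for \<phi> \<psi> \<eta>
    by (simp add: contract_bracket_cochain_self[OF F] lie_bracket_def jacobiator_def of_covec_eq_0_iff)
  have b: "?B \<in> bidegree 2 0"
    using bracket_formula_bidegree[OF cochain_bidegree[OF F(2)] cochain_bidegree[OF F(2)]] by simp
  have b1: "contract (0, \<phi>) ?B \<in> bidegree 1 0" for \<phi>
    using contract_bidegree(2)[OF b, of \<phi>] by simp
  have b2: "contract (0, \<psi>) (contract (0, \<phi>) ?B) \<in> bidegree 0 0" for \<phi> \<psi>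
    using contract_bidegree(2)[OF b1, of \<psi> \<phi>] by simp
  have "contract (0, \<psi>) (contract (0, \<phi>) ?B) = 0" for \<phi> \<psi>
    using bidegree_eq_0_if_contract_covecs[OF b2] z by simp
  then have "contract (0, \<phi>) ?B = 0" for \<phi>
    using bidegree_eq_0_if_contract_covecs[OF b1] by simp
  then show "?B = 0"
    using bidegree_eq_0_if_contract_covecs[OF b] by simp
qed

section \<open>Semisimplicity of skew-symmetric derivations\<close>

text \<open>
  The inner product of two forms of degree $k$, up to the factor $k!$, as the sum of the products of
  their values on all lists of basis covectors.
\<close>

primrec multivector_inner :: "nat \<Rightarrow> 'a::euclidean_space dbl \<Rightarrow> 'a dbl \<Rightarrow> real" where
  "multivector_inner 0 \<sigma> \<tau> = apply_form \<sigma> [] * apply_form \<tau> []"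
| "multivector_inner (Suc k) \<sigma> \<tau> = (\<Sum>b\<in>Basis.
     multivector_inner k (contract (0, blinfun_inner_left b) \<sigma>) (contract (0, blinfun_inner_left b) \<tau>))"

lemma bilinear_multivector_inner: "bilinear (multivector_inner k)"
proof (induction k)
  case (Suc k)
  then show ?case
    unfolding bilinear_def by (auto simp: linear_iff sum.distrib sum_distrib_left)
qed (auto simp: bilinear_def linear_iff algebra_simps)

lemma multivector_inner_nonneg: "0 \<le> multivector_inner k \<Theta> \<Theta>"
  by (induction k arbitrary: \<Theta>) (auto intro: sum_nonneg)

lemma multivector_inner_eq_0:
  assumes "\<Theta> \<in> multivectors k" "multivector_inner k \<Theta> \<Theta> = 0"
  shows "\<Theta> = 0"
  using assms
proof (induction k arbitrary: \<Theta>)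
  case 0
  then show ?case using multivectors_0_E[OF 0(1)] by simp
next
  case (Suc k)
  then show ?case
    by (intro bidegree_eq_0_if_contract_covecs[of \<Theta> "int k" "-1"] Suc.IH contract_covec_multivector)
       (auto simp: sum_nonneg_eq_0_iff multivector_inner_nonneg multivectors_eq_bidegree)
qed

lemma linear_contract_inner: "linear (\<lambda>v::'a::euclidean_space. contract (0::'a, blinfun_inner_left v) \<Theta>)"
proof -
  have "linear (\<lambda>v::'a. (0::'a, blinfun_inner_left v))"
    by (rule linearI) (auto intro!: blinfun_eqI simp: blinfun.add_left blinfun.scaleR_left inner_add_right)
  from linear_compose[OF this linear_contract_left] show ?thesis by (simp add: o_def)
qed

text \<open>
  Contraction with the covector of \<open>v\<close> commutes with the action of \<open>x\<close> up to the induced action on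
  covectors; for a skew-symmetric \<open>br x\<close> the latter is \<open>br x\<close> itself, under the identification of
  vectors with covectors.
\<close>

lemma contract_ad_skew:
  assumes "\<forall>y z. br x y \<bullet> z = - (y \<bullet> br x z)"
  shows "contract (0, blinfun_inner_left v) (ad br x \<Theta>) =
    ad br x (contract (0, blinfun_inner_left v) \<Theta>) - contract (0, blinfun_inner_left (br x v)) \<Theta>"
proof -
  have 1: "v \<bullet> br x c = - (br x v \<bullet> c)" "br x c \<bullet> v = - (br x v \<bullet> c)" for c
    using assms by (metis inner_commute minus_minus)+
  have "contract (0, blinfun_inner_left v) (ad br x \<Theta>) =
     - (\<Sum>c\<in>Basis. (br x v \<bullet> c) *\<^sub>R contract (0, blinfun_inner_left c) \<Theta>)
     + ad br x (contract (0, blinfun_inner_left v) \<Theta>)"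
    using contract_anticomm[of "(0, blinfun_inner_left v)" _ \<Theta>]
    by (simp add: ad_def contract_sum contract_times 1 sum_subtractf sum_negf sum.distrib)
  also have "(\<Sum>c\<in>Basis. (br x v \<bullet> c) *\<^sub>R contract (0, blinfun_inner_left c) \<Theta>) =
      contract (0, blinfun_inner_left (br x v)) \<Theta>"
    by (rule linear_rep[OF linear_contract_inner])
  finally show ?thesis by simp
qed

lemma multivector_inner_ad_skew:
  assumes skew: "\<forall>y z. br x y \<bullet> z = - (y \<bullet> br x z)"
  shows "multivector_inner k (ad br x \<sigma>) \<tau> = - multivector_inner k \<sigma> (ad br x \<tau>)"
proof (induction k arbitrary: \<sigma> \<tau>)
  case 0
  then show ?case by (simp add: ad_def apply_form_sum)
next
  case (Suc k)
  let ?c = "\<lambda>v. contract (0::'a, blinfun_inner_left v)"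
  let ?I = "multivector_inner k"
  have lin: "linear (\<lambda>\<sigma>. ?I \<sigma> \<tau>)" "linear (?I \<sigma>)" for \<sigma> \<tau>
    using bilinear_multivector_inner[of k] by (auto simp: bilinear_def)
  have l: "?I (?c v \<sigma>) \<tau> = (\<Sum>d\<in>Basis. (v \<bullet> d) * ?I (?c d \<sigma>) \<tau>)" for v \<sigma> \<tau>
    using linear_rep[OF linear_compose[OF linear_contract_inner lin(1)], of v \<tau> \<sigma>] by (simp add: o_def)
  have r: "?I \<sigma> (?c v \<tau>) = (\<Sum>d\<in>Basis. (v \<bullet> d) * ?I \<sigma> (?c d \<tau>))" for v \<sigma> \<tau>
    using linear_rep[OF linear_compose[OF linear_contract_inner lin(2)], of v \<sigma> \<tau>] by (simp add: o_def)
  have sk: "br x b \<bullet> d = - (br x d \<bullet> b)" for b d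
    using skew by (metis inner_commute)
  have "(\<Sum>b\<in>Basis. ?I (?c (br x b) \<sigma>) (?c b \<tau>)) =
      (\<Sum>b\<in>Basis. \<Sum>d\<in>Basis. (br x b \<bullet> d) * ?I (?c d \<sigma>) (?c b \<tau>))"
    by (intro sum.cong refl l)
  also have "\<dots> = (\<Sum>d\<in>Basis. \<Sum>b\<in>Basis. - ((br x d \<bullet> b) * ?I (?c d \<sigma>) (?c b \<tau>)))"
    by (subst sum.swap, subst sk) simp
  also have "\<dots> = - (\<Sum>d\<in>Basis. ?I (?c d \<sigma>) (?c (br x d) \<tau>))"
    unfolding r[of _ "br x _"] by (simp add: sum_negf)
  finally have *: "(\<Sum>b\<in>Basis. ?I (?c (br x b) \<sigma>) (?c b \<tau>)) = - (\<Sum>d\<in>Basis. ?I (?c d \<sigma>) (?c (br x d) \<tau>))" .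
  show ?case
    by (simp add: contract_ad_skew[where br = br and x = x, OF skew] linear_diff[OF lin(1)] linear_diff[OF lin(2)] Suc
        sum_subtractf sum_negf *)
qed

text \<open>
  A skew-symmetric operator $D$ satisfies $\langle D\Theta, D\Theta\rangle = -\langle \Theta, D^2\Theta\rangle$,
  so $D^2\Theta = 0$ forces $D\Theta = 0$.
\<close>

lemma ad_skew_semisimple:
  assumes skew: "\<forall>y z. br x y \<bullet> z = - (y \<bullet> br x z)"
    and \<Theta>: "\<Theta> \<in> multivectors k" "ad br x (ad br x \<Theta>) = 0"
  shows "ad br x \<Theta> = 0"
proof (rule multivector_inner_eq_0[OF ad_multivectors[OF \<Theta>(1)]])
  show "multivector_inner k (ad br x \<Theta>) (ad br x \<Theta>) = 0"
    using multivector_inner_ad_skew[where br = br and x = x, OF skew, of k \<Theta> "ad br x \<Theta>"]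
      bilinear_rzero[OF bilinear_multivector_inner, of k \<Theta>] by (simp add: \<Theta>(2))
qed

section \<open>The square of a twisted cocycle\<close>

lemma of_vec_eq_0_iff: "of_vec v = 0 \<longleftrightarrow> v = (0::'a::euclidean_space)"
proof
  assume *: "of_vec v = 0"
  have "v \<bullet> v = 0"
    using arg_cong[OF *, of "\<lambda>\<sigma>. apply_form \<sigma> [(0, blinfun_inner_left v)]"] by (simp add: apply_of_vec)
  then show "v = 0" by simp
qed (simp add: linear_0[OF linear_of_vec])

lemma of_vec_square: "of_vec v * of_vec v = 0"
proof -
  have "2 *\<^sub>R (of_vec v * of_vec v) = of_vec v * of_vec v + of_vec v * of_vec v"
    by (rule scaleR_2)
  also have "\<dots> = of_vec v * of_vec v + of_vec v * parity (of_vec v)"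
    by (simp only: of_vec_parity)
  also have "\<dots> = 0" by simp
  finally show ?thesis by simp
qed

lemma contract_vec_bracket_cochain_self:
  assumes F: "linear F" "\<And>x. F x \<in> multivectors 2"
  shows "contract (x, 0) (bracket_formula (cochain F) (cochain F)) = (-2) *\<^sub>R bracket_formula (cochain F) (F x)"
proof -
  have h: "homogeneous 1 (cochain F)" "homogeneous 0 (F x)"
    using homogeneous_bidegree[OF cochain_bidegree[OF F(2)]] homogeneous_multivector[OF F(2), of x] by simp_all
  have "bracket_formula (F x) (cochain F) = - bracket_formula (cochain F) (F x)"
    using bracket_formula_antisym[OF h(2,1)] by simp
  then show ?thesis
    using parity_hom[OF h(1)] by (simp add: contract_bracket_formula contract_cochain[OF F] scaleR_2)
qed

lemma bracket_multivectors:
  assumes "\<And>x. F x \<in> multivectors 2" "\<Theta> \<in> multivectors 2"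
  shows "bracket_formula (cochain F) \<Theta> \<in> multivectors 3" "bracket_formula \<Theta> (cochain F) \<in> multivectors 3"
  using bracket_formula_bidegree[OF cochain_bidegree[OF assms(1)] assms(2)[unfolded multivectors_eq_bidegree]]
    bracket_formula_bidegree[OF assms(2)[unfolded multivectors_eq_bidegree] cochain_bidegree[OF assms(1)]]
  by (simp_all add: multivectors_eq_bidegree)

lemma bracket_structure_element_multivector:
  assumes "lie_bracket br" "\<Theta> \<in> multivectors k"
  shows "bracket_formula (structure_element br) \<Theta> = cochain (\<lambda>x. ad br x \<Theta>)"
  using coboundary_multivectors[OF assms] by (simp add: coboundary_def big_bracket_eq)

lemma coboundary_eq_0_iff:
  assumes "lie_bracket br" "\<Theta> \<in> multivectors k"
  shows "coboundary br \<Theta> = 0 \<longleftrightarrow> \<Theta> \<in> invariants br k"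
  using assms cochain_eq_0_iff[of "\<lambda>x. ad br x \<Theta>" k] linear_ad_left[of br \<Theta>] ad_multivectors[OF assms(2)]
  by (simp add: coboundary_multivectors invariants_def lie_bracket_def)

text \<open>
  Invariance means being closed under $\delta = \{\mu, \cdot\}$, and $\delta$ is a derivation of the
  big bracket which kills both arguments.
\<close>

lemma bracket_cocycle_invariant:
  assumes br: "lie_bracket br" and F: "F \<in> cocycles br" and \<Theta>: "\<Theta> \<in> invariants br 2"
  shows "bracket_formula (cochain F) \<Theta> \<in> invariants br 3"
proof -
  have F1: "\<And>x. F x \<in> multivectors 2" and \<Theta>1: "\<Theta> \<in> multivectors 2" "\<And>x. ad br x \<Theta> = 0"
    using F \<Theta> by (auto simp: cocycles_def invariants_def)
  let ?m = "structure_element br"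
  have h: "homogeneous 1 ?m" "homogeneous 1 (cochain F)"
    using homogeneous_bidegree[OF structure_element_bidegree] homogeneous_bidegree[OF cochain_bidegree[OF F1]]
    by simp_all
  have "bracket_formula ?m \<Theta> = 0"
    by (simp add: bracket_structure_element_multivector[OF br \<Theta>1(1)] \<Theta>1(2) cochain_def)
  then have "coboundary br (bracket_formula (cochain F) \<Theta>) = 0"
    using bracket_formula_jacobi[OF h, of \<Theta>]
    by (simp add: coboundary_def big_bracket_eq coboundary_cocycle[OF br F])
  then show ?thesis
    using coboundary_eq_0_iff[OF br bracket_multivectors(1)[OF F1 \<Theta>1(1)]] by simp
qed

text \<open>
  With $\delta r = \mathrm{ad}\,r$ and $\delta F = 0 = \delta\delta r$, the derivation property gives
  $\delta\{r, \delta r\} = \{\delta r, \delta r\}$ and $\delta\{r, F\} = \{\delta r, F\}$, so everything in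
  $\{\delta r + F, \delta r + F\}$ except $\{F, F\}$ is a coboundary.
\<close>

lemma twisted_cocycle_square:
  assumes br: "lie_bracket br" and r: "r \<in> multivectors 2" and F: "F \<in> cocycles br"
    and \<Psi>: "\<Psi> = schouten_square br r + 2 *\<^sub>R bracket_formula r (cochain F)"
  shows "bracket_formula (cochain (\<lambda>x. ad br x r + F x)) (cochain (\<lambda>x. ad br x r + F x)) =
      coboundary br \<Psi> + bracket_formula (cochain F) (cochain F)"
    and "\<Psi> \<in> multivectors 3"
proof -
  let ?m = "structure_element br" and ?\<rho> = "cochain (\<lambda>x. ad br x r)"
  have F1: "\<And>x. F x \<in> multivectors 2"
    using F by (auto simp: cocycles_def)
  have \<rho>: "bracket_formula ?m r = ?\<rho>"
    by (rule bracket_structure_element_multivector[OF br r])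
  have h: "homogeneous 1 ?m" "homogeneous 1 (cochain F)" "homogeneous 1 ?\<rho>" "homogeneous 0 r"
    using homogeneous_bidegree[OF structure_element_bidegree] homogeneous_bidegree[OF cochain_bidegree[OF F1]]
      homogeneous_bidegree[OF cochain_bidegree[OF ad_multivectors[OF r]]] homogeneous_multivector[OF r]
    by simp_all
  have "bracket_formula ?m (bracket_formula r \<sigma>) = bracket_formula ?\<rho> \<sigma>" if "bracket_formula ?m \<sigma> = 0" for \<sigma>
    using bracket_formula_jacobi[OF h(1,4), of \<sigma>] by (simp add: that \<rho>)
  note * = this[OF coboundary_cocycle[OF br ad_cocycle[OF br r]]] this[OF coboundary_cocycle[OF br F]]
  have "cochain (\<lambda>x. ad br x r + F x) = ?\<rho> + cochain F"
    by (simp add: cochain_def distrib_left sum.distrib)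
  moreover have "bracket_formula (cochain F) ?\<rho> = bracket_formula ?\<rho> (cochain F)"
    using bracket_formula_antisym[OF h(2,3)] by simp
  ultimately show "bracket_formula (cochain (\<lambda>x. ad br x r + F x)) (cochain (\<lambda>x. ad br x r + F x)) =
      coboundary br \<Psi> + bracket_formula (cochain F) (cochain F)"
    by (simp add: \<Psi> schouten_square_def coboundary_def big_bracket_eq \<rho> * scaleR_2)
  show "\<Psi> \<in> multivectors 3"
    unfolding \<Psi> schouten_square_def big_bracket_eq \<rho>
    by (intro subspace_add[OF subspace_multivectors] subspace_scale[OF subspace_multivectors]
        bracket_multivectors r ad_multivectors F1)
qed

section \<open>Weights of flat metric Lie algebras\<close>

text \<open>
  A group is not the union of two proper subgroups, here the kernels of $f - g$ and $f + g$ on \<open>S\<close>.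
\<close>

lemma squares_eq_imp_eq_or_neg:
  fixes f g :: "'a::real_vector \<Rightarrow> real"
  assumes S: "subspace S"
    and "\<forall>s\<in>S. \<forall>t\<in>S. f (s + t) = f s + f t" "\<forall>s\<in>S. \<forall>t\<in>S. g (s + t) = g s + g t"
    and sq: "\<And>s. s \<in> S \<Longrightarrow> (f s)\<^sup>2 = (g s)\<^sup>2"
  shows "(\<forall>s\<in>S. f s = g s) \<or> (\<forall>s\<in>S. f s = - g s)"
proof (rule ccontr)
  assume "\<not> ?thesis"
  then obtain s t where st: "s \<in> S" "t \<in> S" "f s \<noteq> g s" "f t \<noteq> - g t" by blast
  then have "f s = - g s" "f t = g t" "(f s + f t)\<^sup>2 = (g s + g t)\<^sup>2"
    using sq[of s] sq[of t] sq[of "s + t"] assms(2,3) subspace_add[OF S] by (auto simp: power2_eq_iff)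
  then show False
    using st(3,4) by (auto simp: power2_eq_iff)
qed

locale milnor =
  fixes br :: "'a::euclidean_space \<Rightarrow> 'a \<Rightarrow> 'a" and \<s> :: "'a set" and m :: nat
    and P :: "nat \<Rightarrow> 'a set" and lam :: "nat \<Rightarrow> 'a \<Rightarrow> real" and J :: "nat \<Rightarrow> 'a \<Rightarrow> 'a"
  assumes br: "lie_bracket br"
    and decomposition: "milnor_decomposition br \<s> m P lam J"
    and weights: "\<forall>i\<in>{1..m}. \<forall>j\<in>{1..m}. i \<noteq> j \<longrightarrow>
        \<not> (\<forall>s\<in>\<s>. lam i s = lam j s) \<and> \<not> (\<forall>s\<in>\<s>. lam i s = - lam j s)"
begin

abbreviation "\<z> \<equiv> center br"
abbreviation "\<u> \<equiv> derived_algebra br"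

lemma bil: "bilinear br"
  using br by (simp add: lie_bracket_def)

lemma lin: "linear (br x)"
  using bil by (simp add: bilinear_def)

lemma s_subspace: "subspace \<s>"
  and s_abelian [rule_format]: "\<forall>s\<in>\<s>. \<forall>t\<in>\<s>. br s t = 0"
  and s_orth_u [rule_format]: "\<forall>s\<in>\<s>. \<forall>u\<in>\<u>. s \<bullet> u = 0"
  and z_orth_u [rule_format]: "\<forall>z\<in>\<z>. \<forall>u\<in>\<u>. z \<bullet> u = 0"
  and decomp [rule_format]: "\<forall>x. \<exists>s\<in>\<s>. \<exists>z\<in>\<z>. \<exists>u\<in>\<u>. x = s + z + u"
  and u_abelian [rule_format]: "\<forall>u\<in>\<u>. \<forall>v\<in>\<u>. br u v = 0"
  and u_ideal [rule_format]: "\<forall>x. \<forall>u\<in>\<u>. br x u \<in> \<u>"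
  and s_skew_u [rule_format]: "\<forall>s\<in>\<s>. \<forall>u\<in>\<u>. \<forall>v\<in>\<u>. br s u \<bullet> v = - (u \<bullet> br s v)"
  and P_plane: "\<forall>l\<in>{1..m}. subspace (P l) \<and> dim (P l) = 2 \<and> (\<forall>s\<in>\<s>. \<forall>v\<in>P l. br s v \<in> P l)"
  and P_orth [rule_format]: "\<forall>i\<in>{1..m}. \<forall>j\<in>{1..m}. i \<noteq> j \<longrightarrow> (\<forall>v\<in>P i. \<forall>w\<in>P j. v \<bullet> w = 0)"
  and u_span: "\<u> = span (\<Union>l\<in>{1..m}. P l)"
  and P_weight: "\<forall>l\<in>{1..m}.
        (\<forall>s\<in>\<s>. \<forall>t\<in>\<s>. lam l (s + t) = lam l s + lam l t) \<and> (\<forall>c. \<forall>s\<in>\<s>. lam l (c *\<^sub>R s) = c * lam l s) \<and>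
        (\<exists>s\<in>\<s>. lam l s \<noteq> 0) \<and>
        orthogonal_complex_structure (P l) (J l) \<and>
        (\<forall>s\<in>\<s>. \<forall>v\<in>P l. br s v = lam l s *\<^sub>R J l v)"
  by (insert decomposition[unfolded milnor_decomposition_def Let_def orthogonal_def])
    (elim conjE, assumption)+

lemma P_subspace: "l \<in> {1..m} \<Longrightarrow> subspace (P l)"
  and P_dim: "l \<in> {1..m} \<Longrightarrow> dim (P l) = 2"
  using P_plane by simp_all

lemma lam_add: "l \<in> {1..m} \<Longrightarrow> \<forall>s\<in>\<s>. \<forall>t\<in>\<s>. lam l (s + t) = lam l s + lam l t"
  and lam_nonzero: "l \<in> {1..m} \<Longrightarrow> \<exists>s\<in>\<s>. lam l s \<noteq> 0"
  and J_structure: "l \<in> {1..m} \<Longrightarrow> orthogonal_complex_structure (P l) (J l)"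
  and br_s_P: "l \<in> {1..m} \<Longrightarrow> s \<in> \<s> \<Longrightarrow> v \<in> P l \<Longrightarrow> br s v = lam l s *\<^sub>R J l v"
  using P_weight by simp_all

lemma J_P: "l \<in> {1..m} \<Longrightarrow> v \<in> P l \<Longrightarrow> J l v \<in> P l"
  and J_J: "l \<in> {1..m} \<Longrightarrow> v \<in> P l \<Longrightarrow> J l (J l v) = - v"
  and J_orth: "l \<in> {1..m} \<Longrightarrow> v \<in> P l \<Longrightarrow> w \<in> P l \<Longrightarrow> J l v \<bullet> J l w = v \<bullet> w"
  using J_structure[of l] unfolding orthogonal_complex_structure_def by blast+

lemma P_u: "l \<in> {1..m} \<Longrightarrow> v \<in> P l \<Longrightarrow> v \<in> \<u>"
  unfolding u_span by (intro span_base) auto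

lemma center_br: "z \<in> \<z> \<Longrightarrow> br x z = 0" "z \<in> \<z> \<Longrightarrow> br z x = 0"
  using lie_bracket_skew[OF br, of z x] by (auto simp: center_def)

lemma s_skew:
  assumes "s \<in> \<s>"
  shows "\<forall>y z. br s y \<bullet> z = - (y \<bullet> br s z)"
proof (intro allI)
  fix y z
  obtain s1 z1 u1 where y: "s1 \<in> \<s>" "z1 \<in> \<z>" "u1 \<in> \<u>" "y = s1 + z1 + u1" using decomp by blast
  obtain s2 z2 u2 where z: "s2 \<in> \<s>" "z2 \<in> \<z>" "u2 \<in> \<u>" "z = s2 + z2 + u2" using decomp by blast
  have "br s y = br s u1" "br s z = br s u2"
    using y z by (simp_all add: linear_add[OF lin] s_abelian[OF assms] center_br)
  then show "br s y \<bullet> z = - (y \<bullet> br s z)"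
    using y z s_orth_u[OF _ u_ideal, of _ _ s] z_orth_u[OF _ u_ideal, of _ _ s] s_skew_u[OF assms]
    by (simp add: inner_add_left inner_add_right inner_commute[of "br s u1" s2] inner_commute[of "br s u1" z2])
qed

lemma J_perp:
  assumes "l \<in> {1..m}" "u \<in> P l" shows "J l u \<bullet> u = 0"
  using J_orth[OF assms J_P[OF assms]] J_J[OF assms] inner_commute[of u "J l u"] by simp

lemma br_P_left:
  assumes l: "l \<in> {1..m}" and u: "u \<in> P l"
  shows "\<exists>c. br u x = c *\<^sub>R J l u"
proof -
  obtain s z v where x: "s \<in> \<s>" "z \<in> \<z>" "v \<in> \<u>" "x = s + z + v" using decomp by blast
  have "br u x = (- lam l s) *\<^sub>R J l u"
    using x u_abelian[OF P_u[OF l u]] br_s_P[OF l _ u] lie_bracket_skew[OF br, of u s]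
    by (simp add: linear_add[OF lin] center_br)
  then show ?thesis by blast
qed

lemma orth_all_eq_0:
  assumes "\<And>s. s \<in> \<s> \<Longrightarrow> v \<bullet> s = 0" "\<And>z. z \<in> \<z> \<Longrightarrow> v \<bullet> z = 0"
    "\<And>i w. i \<in> {1..m} \<Longrightarrow> w \<in> P i \<Longrightarrow> v \<bullet> w = 0"
  shows "v = 0"
proof -
  obtain s z u where v: "s \<in> \<s>" "z \<in> \<z>" "u \<in> \<u>" "v = s + z + u" using decomp by blast
  have "orthogonal v u"
    by (rule orthogonal_to_span[OF v(3)[unfolded u_span]]) (auto simp: orthogonal_def assms(3))
  then have "v \<bullet> (s + z + u) = 0"
    by (simp add: inner_add_right assms(1)[OF v(1)] assms(2)[OF v(2)] orthogonal_def)
  then show ?thesis by (simp flip: v(4))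
qed

text \<open>
  This is where distinct weights enter.  The operator $\mathrm{ad}_s^2$ is symmetric, and it is
  $-\lambda_i(s)^2$ on $P_i$ and $0$ on $\mathfrak s \oplus \mathfrak z$.  A common eigenvector with
  eigenvalues $-\lambda_\ell(s)^2$ is therefore orthogonal to everything except $P_\ell$: being
  non-orthogonal to $P_i$ would give $\lambda_i^2 = \lambda_\ell^2$ on $\mathfrak s$, that is,
  $\lambda_i = \pm\lambda_\ell$.
\<close>

lemma isotypic_in_P:
  assumes l: "l \<in> {1..m}" and w: "\<And>s. s \<in> \<s> \<Longrightarrow> br s (br s w) = - (lam l s)\<^sup>2 *\<^sub>R w"
  shows "w \<in> P l"
proof -
  have sk: "br s (br s w) \<bullet> z = w \<bullet> br s (br s z)" if "s \<in> \<s>" for s z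
    using s_skew[OF that] by simp
  obtain s0 where s0: "s0 \<in> \<s>" "lam l s0 \<noteq> 0" using lam_nonzero[OF l] by blast
  have ker: "w \<bullet> x = 0" if "br s0 x = 0" for x
    using sk[OF s0(1), of x] s0(2) w[OF s0(1)] that by (simp add: linear_0[OF lin])
  have wi: "w \<bullet> x = 0" if i: "i \<in> {1..m}" "i \<noteq> l" and x: "x \<in> P i" for i x
  proof (rule ccontr)
    assume "w \<bullet> x \<noteq> 0"
    have "(lam i s)\<^sup>2 = (lam l s)\<^sup>2" if s: "s \<in> \<s>" for s
    proof -
      have "br s (br s x) = - (lam i s)\<^sup>2 *\<^sub>R x"
        using br_s_P[OF i(1) s x] br_s_P[OF i(1) s J_P[OF i(1) x]] J_J[OF i(1) x]
        by (simp add: linear_scale[OF lin] power2_eq_square)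
      then show ?thesis
        using sk[OF s, of x] w[OF s] \<open>w \<bullet> x \<noteq> 0\<close> by simp
    qed
    then have "(\<forall>s\<in>\<s>. lam i s = lam l s) \<or> (\<forall>s\<in>\<s>. lam i s = - lam l s)"
      by (rule squares_eq_imp_eq_or_neg[where f = "lam i" and g = "lam l", OF s_subspace lam_add[OF i(1)] lam_add[OF l]])
    with bspec[OF bspec[OF weights i(1)] l] i(2) show False
      by blast
  qed
  obtain y z where yz: "y \<in> span (P l)" "\<And>v. v \<in> span (P l) \<Longrightarrow> orthogonal z v" "w = y + z"
    using orthogonal_subspace_decomp_exists[of "P l" w] by metis
  have y: "y \<in> P l" using yz(1) by (simp add: span_eq_iff[THEN iffD2, OF P_subspace[OF l]])
  have z: "z = w - y" using yz(3) by simp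
  have "z = 0"
  proof (rule orth_all_eq_0)
    fix s assume s: "s \<in> \<s>"
    have "s \<bullet> y = 0" "w \<bullet> s = 0"
      by (rule s_orth_u[OF s P_u[OF l y]], rule ker[OF s_abelian[OF s0(1) s]])
    then show "z \<bullet> s = 0"
      by (simp add: z inner_diff_left inner_commute[of y])
  next
    fix s assume s: "s \<in> \<z>"
    have "s \<bullet> y = 0" "w \<bullet> s = 0"
      by (rule z_orth_u[OF s P_u[OF l y]], rule ker[OF center_br(1)[OF s]])
    then show "z \<bullet> s = 0"
      by (simp add: z inner_diff_left inner_commute[of y])
  next
    fix i x assume i: "i \<in> {1..m}" "x \<in> P i"
    show "z \<bullet> x = 0"
    proof (cases "i = l")
      case True
      then show ?thesis using yz(2)[of x] i span_base by (auto simp: orthogonal_def)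
    next
      case False
      then show ?thesis using wi[OF i(1) _ i(2)] P_orth[OF l i(1) _ y i(2)] by (simp add: z inner_diff_left)
    qed
  qed
  then show ?thesis using y yz(3) by simp
qed

lemma P_spanned:
  assumes l: "l \<in> {1..m}" and u: "u \<in> P l" "u \<noteq> 0" and w: "w \<in> P l"
  shows "\<exists>a b. w = a *\<^sub>R u + b *\<^sub>R J l u"
proof -
  have jj: "J l u \<bullet> J l u = u \<bullet> u" and ju: "J l u \<bullet> u = 0"
    using J_orth[OF l u(1) u(1)] J_perp[OF l u(1)] by blast+
  have uu: "u \<bullet> u \<noteq> 0" using u(2) by simp
  have n: "J l u \<noteq> 0" "J l u \<noteq> u"
    using uu jj ju by (metis inner_zero_left, metis)
  have "pairwise orthogonal {u, J l u}"
    using ju inner_commute[of u "J l u"] by (simp add: pairwise_insert orthogonal_def)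
  then have "independent {u, J l u}"
    using u(2) n(1) by (intro pairwise_orthogonal_independent) auto
  moreover have "{u, J l u} \<subseteq> P l" "dim (P l) \<le> card {u, J l u}"
    using u(1) J_P[OF l u(1)] P_dim[OF l] n(2) by auto
  ultimately have "P l \<subseteq> span {u, J l u}"
    by (metis card_ge_dim_independent)
  then have "w \<in> span {u, J l u}"
    using w by blast
  then obtain a where "w - a *\<^sub>R u \<in> span {J l u}"
    using span_breakdown_eq[of w u "{J l u}"] by blast
  then obtain b where "w - a *\<^sub>R u = b *\<^sub>R J l u"
    by (auto simp: span_singleton)
  then have "w = a *\<^sub>R u + b *\<^sub>R J l u"
    by (metis add.commute diff_add_cancel)
  then show ?thesis by blast
qed

text \<open>
  Contracting an invariant bivector defines a linear map from covectors, hence from vectors, to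
  vectors, which commutes with $\mathrm{ad}_s$.  It preserves the eigenspaces of $\mathrm{ad}_s^2$, so it
  maps $P_\ell$ into $P_\ell$.
\<close>

lemma contract_invariant_in_P:
  assumes l: "l \<in> {1..m}" and v: "v \<in> P l" and \<omega>: "\<omega> \<in> invariants br 2"
  obtains w where "w \<in> P l" "contract (0, blinfun_inner_left v) \<omega> = of_vec w"
proof -
  let ?c = "\<lambda>v. contract (0::'a, blinfun_inner_left v) \<omega>"
  have \<omega>': "\<omega> \<in> multivectors 2" "\<And>x. ad br x \<omega> = 0"
    using \<omega> by (auto simp: invariants_def)
  then have "?c v \<in> multivectors 1"
    by (intro contract_covec_multivector) (simp add: numeral_2_eq_2)
  then obtain w where w: "?c v = of_vec w" by (rule multivectors_1_E)
  have comm: "ad br s (?c x) = ?c (br s x)" if "s \<in> \<s>" for s x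
    using contract_ad_skew[where br = br and x = s, OF s_skew[OF that], of x \<omega>] \<omega>'(2) by simp
  have "br s (br s w) = - (lam l s)\<^sup>2 *\<^sub>R w" if s: "s \<in> \<s>" for s
  proof -
    have "br s (br s v) = - (lam l s)\<^sup>2 *\<^sub>R v"
      using br_s_P[OF l s v] br_s_P[OF l s J_P[OF l v]] J_J[OF l v]
      by (simp add: linear_scale[OF lin] power2_eq_square)
    then have "?c (br s (br s v)) = - (lam l s)\<^sup>2 *\<^sub>R ?c v"
      using linear_scale[OF linear_contract_inner[of \<omega>], of "- (lam l s)\<^sup>2" v] by simp
    then have "ad br s (ad br s (of_vec w)) = - (lam l s)\<^sup>2 *\<^sub>R of_vec w"
      by (simp only: comm[OF s] flip: w)
    then have "of_vec (br s (br s w) - - (lam l s)\<^sup>2 *\<^sub>R w) = 0"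
      by (simp add: ad_of_vec lin linear_add[OF linear_of_vec] linear_scale[OF linear_of_vec])
    then show ?thesis unfolding of_vec_eq_0_iff right_minus_eq .
  qed
  then show thesis using that isotypic_in_P[OF l] w by blast
qed

text \<open>
  All brackets $[u, x]$ are multiples of $J u$, so $\mathrm{ad}_u\Psi$ is divisible by $J u$ and
  $J u \wedge \omega \wedge u = 0$.  Contracting with $J u$ leaves
  $|J u|^2\, \omega \wedge u = J u \wedge w \wedge u$, where $w$ is the contraction of $\omega$; since $w$
  lies in the plane spanned by $u$ and $J u$, the right-hand side vanishes.
\<close>

lemma ad_image_meets_invariant_multiples:
  assumes l: "l \<in> {1..m}" and u: "u \<in> P l" and \<omega>: "\<omega> \<in> invariants br 2"
    and eq: "ad br u \<Psi> = \<omega> * of_vec u"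
  shows "\<omega> * of_vec u = 0"
proof (cases "u = 0")
  case False
  let ?j = "J l u"
  have "of_vec ?j * of_vec (br u b) = 0" for b
    using br_P_left[OF l u, of b] by (auto simp: linear_scale[OF linear_of_vec] of_vec_square)
  then have "of_vec ?j * ad br u \<Psi> = 0"
    by (simp add: ad_def sum_distrib_left flip: mult.assoc)
  then have 0: "of_vec ?j * (\<omega> * of_vec u) = 0"
    by (simp add: eq)
  obtain w where w: "w \<in> P l" "contract (0, blinfun_inner_left ?j) \<omega> = of_vec w"
    using contract_invariant_in_P[OF l J_P[OF l u] \<omega>] .
  have "of_vec ?j * of_vec w * of_vec u = 0"
  proof -
    obtain a b where "w = a *\<^sub>R u + b *\<^sub>R ?j" using P_spanned[OF l u False w(1)] by blast
    then show ?thesis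
      by (simp add: linear_add[OF linear_of_vec] linear_scale[OF linear_of_vec] distrib_left distrib_right
          of_vec_square mult.assoc)
  qed
  moreover have "(?j \<bullet> ?j) *\<^sub>R (\<omega> * of_vec u) = of_vec ?j * of_vec w * of_vec u"
    using arg_cong[OF 0, of "contract (0, blinfun_inner_left ?j)"] J_perp[OF l u]
    by (simp add: contract_times w(2) inner_commute mult.assoc)
  moreover have "?j \<bullet> ?j \<noteq> 0" using J_orth[OF l u u] False by simp
  ultimately show ?thesis by simp
qed (simp add: linear_0[OF linear_of_vec])

section \<open>Separating the two terms of the square\<close>

text \<open>
  Contracting the equation with $x$ turns it into $\mathrm{ad}_x\Psi = 2\{R, R(x)\}$, and
  $\{R, R\} = 0$ means that the right-hand side vanishes for all $x$.  For
  $x \in \mathfrak s \oplus \mathfrak z$ the right-hand side is invariant, so $\mathrm{ad}_x^2\Psi = 0$ and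
  semisimplicity applies.  For $u \in P_\ell$ with $R(u) = A \wedge u$ the right-hand side is
  $2 R(A) \wedge u$, a multiple of $u$ by an invariant bivector.
\<close>

lemma cocycle_square_zero:
  assumes R: "R \<in> cocycles br"
    and R_a: "\<And>s z. s \<in> \<s> \<Longrightarrow> z \<in> \<z> \<Longrightarrow> R (s + z) \<in> invariants br 2"
    and R_P: "\<And>l. l \<in> {1..m} \<Longrightarrow> \<exists>s\<in>\<s>. \<exists>z\<in>\<z>. \<forall>u\<in>P l. R u = of_vec (s + z) * of_vec u"
    and \<Psi>: "\<Psi> \<in> multivectors 3"
    and eq: "coboundary br \<Psi> + bracket_formula (cochain R) (cochain R) = 0"
  shows "bracket_formula (cochain R) (cochain R) = 0"
proof -
  let ?X = "cochain R"
  have R1: "linear R" "\<And>x. R x \<in> multivectors 2" using R by (auto simp: cocycles_def)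
  have ad\<Psi>: "ad br x \<Psi> = 2 *\<^sub>R bracket_formula ?X (R x)" for x
  proof -
    have "contract (x, 0) (coboundary br \<Psi>) = ad br x \<Psi>"
      using coboundary_multivectors[OF br \<Psi>] contract_cochain[OF linear_ad_left[OF bil] ad_multivectors[OF \<Psi>]] by simp
    then show ?thesis
      using arg_cong[OF eq, of "contract (x, 0)"] by (simp add: contract_vec_bracket_cochain_self[OF R1])
  qed
  have a: "bracket_formula ?X (R (s + z)) = 0" if sz: "s \<in> \<s>" "z \<in> \<z>" for s z
  proof -
    have inv: "bracket_formula ?X (R (s + z)) \<in> invariants br 3"
      by (rule bracket_cocycle_invariant[OF br R R_a[OF sz]])
    have "br (s + z) = br s"
      using center_br(2)[OF sz(2)] by (simp add: fun_eq_iff bilinear_ladd[OF bil])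
    then have "\<forall>x y. br (s + z) x \<bullet> y = - (x \<bullet> br (s + z) y)" using s_skew[OF sz(1)] by simp
    moreover have "ad br (s + z) (ad br (s + z) \<Psi>) = 0"
      using inv by (simp add: ad\<Psi> invariants_def linear_scale[OF linear_ad])
    ultimately have "ad br (s + z) \<Psi> = 0"
      using ad_skew_semisimple[where br = br and x = "s + z", OF _ \<Psi>] by blast
    then show ?thesis by (simp add: ad\<Psi>)
  qed
  have P: "bracket_formula ?X (R u) = 0" if l: "l \<in> {1..m}" and u: "u \<in> P l" for l u
  proof -
    obtain s z where sz: "s \<in> \<s>" "z \<in> \<z>" and Ru: "R u = of_vec (s + z) * of_vec u"
      using R_P[OF l] u by blast
    let ?A = "s + z"
    have h: "homogeneous 1 ?X"
      using homogeneous_bidegree[OF cochain_bidegree[OF R1(2)]] by simp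
    \<comment> \<open>The other term of the derivation rule is $A \wedge A \wedge u = 0$.\<close>
    have "bracket_formula ?X (R u) = R ?A * of_vec u"
      using bracket_formula_deriv[OF h homogeneous_of_vec, of ?A "of_vec u"]
      by (simp add: Ru bracket_of_vec_cochain[OF R1] powi_neg1 of_vec_square flip: mult.assoc)
    moreover have "(2 *\<^sub>R R ?A) * of_vec u = 0"
    proof (rule ad_image_meets_invariant_multiples[OF l u])
      show "2 *\<^sub>R R ?A \<in> invariants br 2"
        using R_a[OF sz] by (simp add: invariants_def linear_scale[OF linear_ad] subspace_scale[OF subspace_multivectors])
      show "ad br u \<Psi> = 2 *\<^sub>R R ?A * of_vec u" by (simp add: ad\<Psi> calculation)
    qed
    ultimately show ?thesis by simp
  qed
  have lin: "linear (\<lambda>x. bracket_formula ?X (R x))"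
    using R1(1) by (simp add: linear_iff)
  have "bracket_formula ?X (R x) = 0" for x
  proof -
    obtain s z u where x: "s \<in> \<s>" "z \<in> \<z>" "u \<in> \<u>" "x = s + z + u" using decomp by blast
    have "bracket_formula ?X (R u) = 0"
      by (rule linear_eq_0_on_span[OF lin _ x(3)[unfolded u_span]]) (use P in auto)
    then show ?thesis using a[OF x(1,2)] by (simp add: x(4) linear_add[OF R1(1)])
  qed
  then have "contract (x, 0) (bracket_formula ?X ?X) = 0" for x
    by (simp add: contract_vec_bracket_cochain_self[OF R1])
  moreover have "bracket_formula ?X ?X \<in> bidegree 2 0"
    using bracket_formula_bidegree[OF cochain_bidegree[OF R1(2)] cochain_bidegree[OF R1(2)]] by simp
  ultimately show ?thesis using bidegree_eq_0_if_contract_vecs[of "bracket_formula ?X ?X" 2 0] by simp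
qed

end

section \<open>The equivalence\<close>

theorem theorem5p6:
  fixes br :: "'a::euclidean_space \<Rightarrow> 'a \<Rightarrow> 'a"
    and \<s> \<a> :: "'a set" and m :: nat and P :: "nat \<Rightarrow> 'a set"
    and lam :: "nat \<Rightarrow> 'a \<Rightarrow> real" and J :: "nat \<Rightarrow> 'a \<Rightarrow> 'a"
    and r \<Psi> :: "'a dbl" and R \<xi> :: "'a \<Rightarrow> 'a dbl"
  assumes flat: "flat_metric_lie_algebra br"
    and decomposition: "milnor_decomposition br \<s> m P lam J"
    and \<a>: "\<a> = {s + z |s z. s \<in> \<s> \<and> z \<in> center br}"
    and weights: "\<forall>i\<in>{1..m}. \<forall>j\<in>{1..m}. i \<noteq> j \<longrightarrow>
        \<not> (\<forall>s\<in>\<s>. lam i s = lam j s) \<and> \<not> (\<forall>s\<in>\<s>. lam i s = - lam j s)"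
    and r: "r \<in> multivectors 2"
    and R: "R \<in> cocycles br"
    and R_\<a>: "\<forall>a\<in>\<a>. R a \<in> invariants br 2"
    and R_P: "\<forall>l\<in>{1..m}. \<exists>A\<in>\<a>. \<forall>u\<in>P l. R u = of_vec A * of_vec u"
    and \<xi>: "\<xi> = (\<lambda>x. ad br x r + R x)"
    and \<Psi>: "\<Psi> = schouten_square br r + 2 *\<^sub>R big_bracket r (cochain R)"
  shows
    "(lie_bialgebra_structure br \<xi> \<longleftrightarrow> big_bracket (cochain \<xi>) (cochain \<xi>) = 0) \<and>
     (big_bracket (cochain \<xi>) (cochain \<xi>) = 0 \<longleftrightarrow>
        big_bracket (cochain R) (cochain R) = 0 \<and> coboundary br \<Psi> = 0) \<and>
     (big_bracket (cochain R) (cochain R) = 0 \<and> coboundary br \<Psi> = 0 \<longleftrightarrow>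
        big_bracket (cochain R) (cochain R) = 0 \<and> \<Psi> \<in> invariants br 3)"
proof -
  have br: "lie_bracket br" using flat by (simp add: flat_metric_lie_algebra_def)
  interpret milnor br \<s> m P lam J
    using br decomposition weights by unfold_locales
  have "\<xi> \<in> cocycles br"
    using ad_cocycle[OF br r] R unfolding \<xi>
    by (auto simp: cocycles_def linear_ad linear_add[OF linear_ad] intro!: linear_compose_add subspace_add[OF subspace_multivectors])
  then have "lie_bialgebra_structure br \<xi> \<longleftrightarrow> bracket_formula (cochain \<xi>) (cochain \<xi>) = 0"
    using lie_bracket_dual_bracket_iff[of \<xi>] by (simp add: lie_bialgebra_structure_def cocycles_def)
  moreover note sq = twisted_cocycle_square[OF br r R \<Psi>[unfolded big_bracket_eq], folded \<xi>]
  have "bracket_formula (cochain R) (cochain R) = 0" if "bracket_formula (cochain \<xi>) (cochain \<xi>) = 0"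
  proof (rule cocycle_square_zero[OF R _ _ sq(2)])
    show "R (s + z) \<in> invariants br 2" if "s \<in> \<s>" "z \<in> \<z>" for s z
      using that R_\<a> \<a> by blast
    show "\<exists>s\<in>\<s>. \<exists>z\<in>\<z>. \<forall>u\<in>P l. R u = of_vec (s + z) * of_vec u" if "l \<in> {1..m}" for l
      using bspec[OF R_P that] unfolding \<a> by blast
    show "coboundary br \<Psi> + bracket_formula (cochain R) (cochain R) = 0"
      using that sq(1) by simp
  qed
  then have "bracket_formula (cochain \<xi>) (cochain \<xi>) = 0 \<longleftrightarrow>
      bracket_formula (cochain R) (cochain R) = 0 \<and> coboundary br \<Psi> = 0"
    using sq(1) by auto
  ultimately show ?thesis
    using coboundary_eq_0_iff[OF br sq(2)] unfolding big_bracket_eq by blast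
qed

end
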